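(* Let $M$ be a $(2n+1)$-dimensional smooth contact manifold equipped with a Heisenberg structure with contact form $\alpha$ and vector fields $A_1,\dots,A_n,B_1,\dots,B_n,Z$. Identify a tangent vector field $X=\sum_{i=1}^n(F_iA_i+G_iB_i)\in\mathrm{TVect}(M)$ with the column $\begin{pmatrix}F\\ G\end{pmatrix}$ of its coefficients, where $F=(F_1,\dots,F_n)$ and $G=(G_1,\dots,G_n)$ are $n$-vector functions. Then the action of $\mathrm{CVect}(M)$ on $\mathrm{TVect}(M)$ (by Lie bracket, $X\mapsto[X_H,X]$) is given by the first-order $(2n\times 2n)$-matrix differential operator $$X_H\begin{pmatrix}F\\ G\end{pmatrix}=\left(X_H\cdot\mathbf{1}-\begin{pmatrix}AB(H)&BB(H)\\ -AA(H)&-BA(H)\end{pmatrix}\right)\begin{pmatrix}F\\ G\end{pmatrix},$$ where $\mathbf{1}$ is the unit $(2n\times 2n)$-matrix and $AA(H),AB(H),BA(H),BB(H)$ are the $(n\times n)$-matrices with entries $$AA(H)_{ij}=A_jA_i(H),\quad AB(H)_{ij}=A_jB_i(H),\quad BA(H)_{ij}=B_jA_i(H),\quad BB(H)_{ij}=B_jB_i(H)$$ ($i$ being the row index and $j$ the column index).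
   Context: A contact structure $\xi$ on a $(2n+1)$-dimensional smooth manifold $M$ ($n\ge 1$) is a completely non-integrable codimension 1 distribution; a contact form is a real 1-form $\alpha$ with $\xi=\ker\alpha$ and $\alpha\wedge(d\alpha)^n\neq0$ everywhere. The Reeb field of $\alpha$ is the vector field $Z$ with $Z\in\ker d\alpha$ and $\alpha(Z)\equiv 1$. $M$ is equipped with a Heisenberg structure if one fixes a contact form $\alpha$ on $M$ and $2n+1$ vector fields $A_1,\dots,A_n,B_1,\dots,B_n,Z$ on $M$ such that: $Z$ is the Reeb field of $\alpha$; the $2n$ vector fields $A_i,B_j$ are linearly independent at every point and tangent to the contact structure, $\alpha(A_i)=\alpha(B_j)=0$; and $[A_i,B_j]=\delta_{ij}Z$, while all other brackets are zero: $[A_i,A_j]=[B_i,B_j]=[A_i,Z]=[B_i,Z]=0$. $\mathrm{CVect}(M)$ is the Lie algebra of contact vector fields, i.e. of (complex) vector fields $X$ with $L_X\alpha=f_X\alpha$ for some function $f_X$. The map $X\mapsto H=\alpha(X)$ (contact Hamiltonian) is a bijection from $\mathrm{CVect}(M)$ onto complex-valued smooth functions, and $X_H$ denotes the contact vector field with contact Hamiltonian $H$. $\mathrm{TVect}(M)$ is the space of (complex) vector fields tangent to $\xi$; the fields $A_i,B_j$ form a basis of it over $C^\infty(M)$, so every $X\in\mathrm{TVect}(M)$ has a unique decomposition $X=\sum_i(F_iA_i+G_iB_i)$ with smooth complex-valued $F_i,G_i$. $X_H\cdot\mathbf{1}$ means that $X_H$ is applied to each component. $A_jB_i(H)$ means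 $A_j(B_i(H))$, and similarly for the others. *)

theory Defs
  imports "HOL-Analysis.Analysis"
begin

section \<open>Smooth manifolds\<close>

text \<open>Smoothness of maps between normed spaces; only meaningful (and only used) on open sets.\<close>

primrec Ck_on :: "nat \<Rightarrow> 'e::real_normed_vector set \<Rightarrow> ('e \<Rightarrow> 'f::real_normed_vector) \<Rightarrow> bool" where
  "Ck_on 0 S f \<longleftrightarrow> continuous_on S f"
| "Ck_on (Suc k) S f \<longleftrightarrow>
     (\<forall>x\<in>S. f differentiable (at x)) \<and> (\<forall>v. Ck_on k S (\<lambda>x. frechet_derivative f (at x) v))"

definition Cinf_on :: "'e::real_normed_vector set \<Rightarrow> ('e \<Rightarrow> 'f::real_normed_vector) \<Rightarrow> bool" where
  "Cinf_on S f \<longleftrightarrow> (\<forall>k. Ck_on k S f)"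

text \<open>The manifold is the whole type \<open>'a\<close>, modelled on the Euclidean space \<open>'e\<close>.
  A chart is a pair of its domain and its coordinate map; the latter is irrelevant
  outside the domain. The atlas need not be maximal.\<close>

type_synonym ('a, 'e) atlas = "('a set \<times> ('a \<Rightarrow> 'e)) set"

definition smooth_atlas ::
    "('a::{t2_space,second_countable_topology}, 'e::euclidean_space) atlas \<Rightarrow> bool" where
  "smooth_atlas \<A> \<longleftrightarrow>
     (\<Union>(U, \<phi>)\<in>\<A>. U) = UNIV \<and>
     (\<forall>(U, \<phi>)\<in>\<A>. open U \<and> open (\<phi> ` U) \<and> homeomorphism U (\<phi> ` U) \<phi> (inv_into U \<phi>)) \<and>
     (\<forall>(U, \<phi>)\<in>\<A>. \<forall>(V, \<psi>)\<in>\<A>. Cinf_on (\<phi> ` (U \<inter> V)) (\<psi> \<circ> inv_into U \<phi>))"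

definition smooth_fun ::
    "('a::topological_space, 'e::euclidean_space) atlas \<Rightarrow> 'a set \<Rightarrow> ('a \<Rightarrow> complex) \<Rightarrow> bool" where
  "smooth_fun \<A> W f \<longleftrightarrow> (\<forall>(U, \<phi>)\<in>\<A>. Cinf_on (\<phi> ` (U \<inter> W)) (f \<circ> inv_into U \<phi>))"

definition smooth_near ::
    "('a::topological_space, 'e::euclidean_space) atlas \<Rightarrow> 'a \<Rightarrow> ('a \<Rightarrow> complex) \<Rightarrow> bool" where
  "smooth_near \<A> p f \<longleftrightarrow> (\<exists>W. open W \<and> p \<in> W \<and> smooth_fun \<A> W f)"

section \<open>Complex vector fields\<close>

text \<open>A complex tangent vector at a point is a complex-linear derivation on germs of
  complex-valued smooth functions. It is represented as a functional on all functions that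
  vanishes on those that are not smooth near the point, so that equality of tangent vectors
  is equality in HOL.\<close>

type_synonym 'a tvec = "('a \<Rightarrow> complex) \<Rightarrow> complex"
type_synonym 'a vfield = "'a \<Rightarrow> 'a tvec"

definition tangent_space ::
    "('a::topological_space, 'e::euclidean_space) atlas \<Rightarrow> 'a \<Rightarrow> 'a tvec set" where
  "tangent_space \<A> p = {D.
     (\<forall>f g. smooth_near \<A> p f \<and> smooth_near \<A> p g \<longrightarrow>
        D (\<lambda>x. f x + g x) = D f + D g \<and>
        D (\<lambda>x. f x * g x) = D f * g p + f p * D g) \<and>
     (\<forall>c f. smooth_near \<A> p f \<longrightarrow> D (\<lambda>x. c * f x) = c * D f) \<and>
     (\<forall>f g. smooth_near \<A> p f \<and> smooth_near \<A> p g \<and> (\<forall>\<^sub>F x in nhds p. f x = g x) \<longrightarrow> D f = D g) \<and>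
     (\<forall>f. \<not> smooth_near \<A> p f \<longrightarrow> D f = 0)}"

definition real_tvec :: "'a tvec \<Rightarrow> bool" where
  "real_tvec D \<longleftrightarrow> (\<forall>f. (\<forall>x. f x \<in> \<real>) \<longrightarrow> D f \<in> \<real>)"

definition vector_field_on ::
    "('a::topological_space, 'e::euclidean_space) atlas \<Rightarrow> 'a set \<Rightarrow> 'a vfield \<Rightarrow> bool" where
  "vector_field_on \<A> U X \<longleftrightarrow>
     (\<forall>p\<in>U. X p \<in> tangent_space \<A> p) \<and>
     (\<forall>W f. open W \<and> W \<subseteq> U \<and> smooth_fun \<A> W f \<longrightarrow> smooth_fun \<A> W (\<lambda>p. X p f))"

abbreviation vector_field ::
    "('a::topological_space, 'e::euclidean_space) atlas \<Rightarrow> 'a vfield \<Rightarrow> bool" where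
  "vector_field \<A> \<equiv> vector_field_on \<A> UNIV"

definition real_vector_field ::
    "('a::topological_space, 'e::euclidean_space) atlas \<Rightarrow> 'a vfield \<Rightarrow> bool" where
  "real_vector_field \<A> X \<longleftrightarrow> vector_field \<A> X \<and> (\<forall>p. real_tvec (X p))"

definition zero_field :: "'a vfield" where
  "zero_field = (\<lambda>p f. 0)"

definition bracket ::
    "('a::topological_space, 'e::euclidean_space) atlas \<Rightarrow> 'a vfield \<Rightarrow> 'a vfield \<Rightarrow> 'a vfield" where
  "bracket \<A> X Y = (\<lambda>p f.
     if smooth_near \<A> p f then X p (\<lambda>q. Y q f) - Y p (\<lambda>q. X q f) else 0)"

section \<open>Differential forms\<close>

text \<open>A real 1-form, extended complex-linearly to complex tangent vectors.\<close>

definition one_form ::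
    "('a::topological_space, 'e::euclidean_space) atlas \<Rightarrow> ('a \<Rightarrow> 'a tvec \<Rightarrow> complex) \<Rightarrow> bool" where
  "one_form \<A> \<alpha> \<longleftrightarrow>
     (\<forall>p. \<forall>D\<in>tangent_space \<A> p. \<forall>E\<in>tangent_space \<A> p. \<forall>c.
        \<alpha> p (\<lambda>f. D f + E f) = \<alpha> p D + \<alpha> p E \<and> \<alpha> p (\<lambda>f. c * D f) = c * \<alpha> p D) \<and>
     (\<forall>p. \<forall>D\<in>tangent_space \<A> p. real_tvec D \<longrightarrow> \<alpha> p D \<in> \<real>) \<and>
     (\<forall>U X. open U \<and> vector_field_on \<A> U X \<longrightarrow> smooth_fun \<A> U (\<lambda>p. \<alpha> p (X p)))"

text \<open>Forms of higher degree are given by their values on sequences of vector fields;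
  a \<open>k\<close>-form reads only the first \<open>k\<close> entries of the sequence.\<close>

type_synonym 'a form = "(nat \<Rightarrow> 'a vfield) \<Rightarrow> 'a \<Rightarrow> complex"

definition form_of :: "('a \<Rightarrow> 'a tvec \<Rightarrow> complex) \<Rightarrow> 'a form" where
  "form_of \<alpha> = (\<lambda>X p. \<alpha> p (X 0 p))"

definition ext_deriv ::
    "('a::topological_space, 'e::euclidean_space) atlas \<Rightarrow> ('a \<Rightarrow> 'a tvec \<Rightarrow> complex) \<Rightarrow> 'a form" where
  "ext_deriv \<A> \<alpha> = (\<lambda>X p.
     X 0 p (\<lambda>q. \<alpha> q (X 1 q)) - X 1 p (\<lambda>q. \<alpha> q (X 0 q)) - \<alpha> p (bracket \<A> (X 0) (X 1) p))"

definition wedge :: "nat \<Rightarrow> nat \<Rightarrow> 'a form \<Rightarrow> 'a form \<Rightarrow> 'a form" where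
  "wedge k l \<omega> \<eta> = (\<lambda>X p.
     (\<Sum>\<sigma> | \<sigma> permutes {..<k + l}.
        of_int (sign \<sigma>) * \<omega> (\<lambda>i. X (\<sigma> i)) p * \<eta> (\<lambda>i. X (\<sigma> (k + i))) p) / (fact k * fact l))"

primrec wedge_power :: "nat \<Rightarrow> 'a form \<Rightarrow> nat \<Rightarrow> 'a form" where
  "wedge_power k \<omega> 0 = (\<lambda>X p. 1)"
| "wedge_power k \<omega> (Suc m) = wedge k (k * m) \<omega> (wedge_power k \<omega> m)"

section \<open>Contact and Heisenberg structures\<close>

definition contact_form ::
    "('a::topological_space, 'e::euclidean_space) atlas \<Rightarrow> nat \<Rightarrow> ('a \<Rightarrow> 'a tvec \<Rightarrow> complex) \<Rightarrow> bool" where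
  "contact_form \<A> n \<alpha> \<longleftrightarrow>
     one_form \<A> \<alpha> \<and>
     (\<forall>p. \<exists>X. (\<forall>i<2 * n + 1. real_vector_field \<A> (X i)) \<and>
        wedge 1 (2 * n) (form_of \<alpha>) (wedge_power 2 (ext_deriv \<A> \<alpha>) n) X p \<noteq> 0)"

definition reeb_field ::
    "('a::topological_space, 'e::euclidean_space) atlas \<Rightarrow> ('a \<Rightarrow> 'a tvec \<Rightarrow> complex) \<Rightarrow> 'a vfield \<Rightarrow> bool" where
  "reeb_field \<A> \<alpha> Z \<longleftrightarrow>
     real_vector_field \<A> Z \<and>
     (\<forall>Y. real_vector_field \<A> Y \<longrightarrow> (\<forall>p. ext_deriv \<A> \<alpha> (\<lambda>i. if i = 0 then Z else Y) p = 0)) \<and>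
     (\<forall>p. \<alpha> p (Z p) = 1)"

definition heisenberg_structure ::
    "('a::topological_space, 'e::euclidean_space) atlas \<Rightarrow> ('a \<Rightarrow> 'a tvec \<Rightarrow> complex) \<Rightarrow>
      ('n::finite \<Rightarrow> 'a vfield) \<Rightarrow> ('n \<Rightarrow> 'a vfield) \<Rightarrow> 'a vfield \<Rightarrow> bool" where
  "heisenberg_structure \<A> \<alpha> A B Z \<longleftrightarrow>
     contact_form \<A> CARD('n) \<alpha> \<and>
     reeb_field \<A> \<alpha> Z \<and>
     (\<forall>i. real_vector_field \<A> (A i) \<and> real_vector_field \<A> (B i)) \<and>
     (\<forall>p. \<forall>a b :: 'n \<Rightarrow> real.
        (\<forall>f. (\<Sum>i\<in>UNIV. of_real (a i) * A i p f + of_real (b i) * B i p f) = 0) \<longrightarrow>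
        (\<forall>i. a i = 0 \<and> b i = 0)) \<and>
     (\<forall>i p. \<alpha> p (A i p) = 0 \<and> \<alpha> p (B i p) = 0) \<and>
     (\<forall>i j. bracket \<A> (A i) (B j) = (if i = j then Z else zero_field)) \<and>
     (\<forall>i j. bracket \<A> (A i) (A j) = zero_field \<and> bracket \<A> (B i) (B j) = zero_field) \<and>
     (\<forall>i. bracket \<A> (A i) Z = zero_field \<and> bracket \<A> (B i) Z = zero_field)"

section \<open>Contact and tangent vector fields\<close>

text \<open>The Lie derivative of a 1-form, evaluated on a vector field \<open>Y\<close>.\<close>

definition lie_deriv ::
    "('a::topological_space, 'e::euclidean_space) atlas \<Rightarrow> 'a vfield \<Rightarrow> ('a \<Rightarrow> 'a tvec \<Rightarrow> complex) \<Rightarrow>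
      'a vfield \<Rightarrow> 'a \<Rightarrow> complex" where
  "lie_deriv \<A> X \<alpha> Y p = X p (\<lambda>q. \<alpha> q (Y q)) - \<alpha> p (bracket \<A> X Y p)"

definition CVect ::
    "('a::topological_space, 'e::euclidean_space) atlas \<Rightarrow> ('a \<Rightarrow> 'a tvec \<Rightarrow> complex) \<Rightarrow> 'a vfield set" where
  "CVect \<A> \<alpha> = {X. vector_field \<A> X \<and>
     (\<exists>f. \<forall>Y. vector_field \<A> Y \<longrightarrow> (\<forall>p. lie_deriv \<A> X \<alpha> Y p = f p * \<alpha> p (Y p)))}"

definition contact_field ::
    "('a::topological_space, 'e::euclidean_space) atlas \<Rightarrow> ('a \<Rightarrow> 'a tvec \<Rightarrow> complex) \<Rightarrow>
      ('a \<Rightarrow> complex) \<Rightarrow> 'a vfield" where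
  "contact_field \<A> \<alpha> H = (THE X. X \<in> CVect \<A> \<alpha> \<and> (\<forall>p. \<alpha> p (X p) = H p))"

definition TVect ::
    "('a::topological_space, 'e::euclidean_space) atlas \<Rightarrow> ('a \<Rightarrow> 'a tvec \<Rightarrow> complex) \<Rightarrow> 'a vfield set" where
  "TVect \<A> \<alpha> = {X. vector_field \<A> X \<and> (\<forall>p. \<alpha> p (X p) = 0)}"

text \<open>Columns of \<open>2n\<close> functions: the \<open>Inl\<close> components are \<open>F\<close>, the \<open>Inr\<close> components are \<open>G\<close>.\<close>

definition field_of_column ::
    "('n::finite \<Rightarrow> 'a vfield) \<Rightarrow> ('n \<Rightarrow> 'a vfield) \<Rightarrow> ('a \<Rightarrow> complex ^ ('n + 'n)) \<Rightarrow> 'a vfield" where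
  "field_of_column A B V = (\<lambda>p f. \<Sum>i\<in>UNIV. V p $ Inl i * A i p f + V p $ Inr i * B i p f)"

definition coeff_column ::
    "('a::topological_space, 'e::euclidean_space) atlas \<Rightarrow> ('n::finite \<Rightarrow> 'a vfield) \<Rightarrow>
      ('n \<Rightarrow> 'a vfield) \<Rightarrow> 'a vfield \<Rightarrow> 'a \<Rightarrow> complex ^ ('n + 'n)" where
  "coeff_column \<A> A B X = (THE V.
     (\<forall>k. smooth_fun \<A> UNIV (\<lambda>p. V p $ k)) \<and> X = field_of_column A B V)"

section \<open>Matrices of second derivatives\<close>

text \<open>The outer derivation carries the column index: \<open>second_deriv A B H\<close> is \<open>AB(H)\<close>,
  with entries \<open>A\<^sub>j (B\<^sub>i (H))\<close> in row \<open>i\<close> and column \<open>j\<close>.\<close>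

definition second_deriv ::
    "('n::finite \<Rightarrow> 'a vfield) \<Rightarrow> ('n \<Rightarrow> 'a vfield) \<Rightarrow> ('a \<Rightarrow> complex) \<Rightarrow> 'a \<Rightarrow> complex ^ 'n ^ 'n" where
  "second_deriv P Q H p = (\<chi> i j. P j p (\<lambda>q. Q i q H))"

definition block_matrix ::
    "'b ^ 'n ^ 'n \<Rightarrow> 'b ^ 'n ^ 'n \<Rightarrow> 'b ^ 'n ^ 'n \<Rightarrow> 'b ^ 'n ^ 'n \<Rightarrow> 'b ^ ('n + 'n) ^ ('n::finite + 'n)" where
  "block_matrix P Q R S = (\<chi> r c. case r of
      Inl i \<Rightarrow> (case c of Inl j \<Rightarrow> P $ i $ j | Inr j \<Rightarrow> Q $ i $ j)
    | Inr i \<Rightarrow> (case c of Inl j \<Rightarrow> R $ i $ j | Inr j \<Rightarrow> S $ i $ j))"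

text \<open>The operator \<open>X 1\<close> (\<open>1\<close> the unit matrix), applying a vector field to each component of a column.\<close>

definition componentwise :: "'a vfield \<Rightarrow> ('a \<Rightarrow> complex ^ 'm) \<Rightarrow> 'a \<Rightarrow> complex ^ 'm" where
  "componentwise X V p = (\<chi> k. X p (\<lambda>q. V q $ k))"

end

theory Submission
  imports Defs
begin

text \<open>Writing fields in the frame \<open>A\<^sub>i, B\<^sub>i, Z\<close>, the commutation relations turn the Leibniz rule into
  \<open>[u, v] = \<Sum>\<^sub>k (u(v\<^sub>k) - v(u\<^sub>k)) E\<^sub>k + \<omega>(u, v) Z\<close> with \<open>\<omega>\<close> the standard symplectic form. Hence the contact
  field of \<open>H\<close> is \<open>H Z + \<Sum>\<^sub>i (B\<^sub>i(H) A\<^sub>i - A\<^sub>i(H) B\<^sub>i)\<close>, and for tangent \<open>v\<close> the \<open>Z\<close>-component of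
  \<open>[X\<^sub>H, v]\<close> cancels while the others give the matrix of second derivatives.

  That the frame is a basis needs the tangent space to have dimension \<open>2n + 1\<close>, which for derivations
  of germs is Hadamard's lemma. That the coefficients of a smooth field are smooth follows from
  tensoriality of \<open>d\<alpha>\<close>: up to sign they are \<open>\<alpha>(Y)\<close>, \<open>d\<alpha>(Y, A\<^sub>i)\<close> and \<open>d\<alpha>(Y, B\<^sub>i)\<close>.\<close>

section \<open>Calculus of smooth maps\<close>

text \<open>For a field \<open>X\<close> with coefficients \<open>u\<close> and
  \<open>\<alpha>(X) = H\<close>, the Lie derivative of \<open>\<alpha>\<close> evaluated on
  \<open>v\<close> is \<open>v(H) - \<omega>(u, v)\<close>, and the contact condition makes it
  vanish for tangent \<open>v\<close>. So \<open>\<omega>(u, v) = v(H)\<close> there, which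
  determines the tangent part of \<open>X\<close>. The same identity cancels the
  \<open>Z\<close>-component of the bracket, and second derivatives of \<open>H\<close> arise
  because \<open>- v(u_k)\<close> differentiates coefficients that are themselves first derivatives
  of \<open>H\<close>. Two gaps shape the rest. Independence of the frame is assumed over the reals,
  whereas tangent vectors are complex; since the frame is real in coordinates, real and imaginary
  parts can be treated separately. And frame coefficients first exist only point by point, so a
  bracket formula that differentiates them cannot be used to prove them smooth. Tensoriality is
  therefore proved in a chart, where the coefficients \<open>Y(x_b)\<close> are smooth because
  \<open>Y\<close> preserves smoothness. Coordinate fields exist only on the chart domain, which is
  why brackets and 1-forms are handled for fields on open sets.\<close>

lemma Ck_on_subset: "Ck_on k S f \<Longrightarrow> T \<subseteq> S \<Longrightarrow> Ck_on k T f"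
  by (induction k arbitrary: f) (auto intro: continuous_on_subset)

lemma Ck_on_cong:
  assumes "open S" "\<And>x. x \<in> S \<Longrightarrow> f x = g x" "Ck_on k S f"
  shows "Ck_on k S g"
  using assms(2,3)
proof (induction k arbitrary: f g)
  case 0
  then show ?case by (simp cong: continuous_on_cong)
next
  case (Suc k)
  have "g differentiable at x" if "x \<in> S" for x
    using Suc.prems that \<open>open S\<close>
    by (metis Ck_on.simps(2) differentiable_def has_derivative_transform_within_open)
  moreover have "Ck_on k S (\<lambda>x. frechet_derivative g (at x) v)" for v
    by (rule Suc.IH[of "\<lambda>x. frechet_derivative f (at x) v"])
      (use Suc.prems \<open>open S\<close> in \<open>auto simp: frechet_derivative_transform_within_open\<close>)
  ultimately show ?case by simp
qed

text \<open>\<open>frechet_derivative\<close> is a choice operator. An explicit derivative formula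
  may replace it because derivatives are unique and \<open>Ck_on_cong\<close> transfers regularity
  on open sets.\<close>

lemma Ck_on_SucI:
  assumes "open S" "\<And>x. x \<in> S \<Longrightarrow> (f has_derivative f' x) (at x)" "\<And>v. Ck_on k S (\<lambda>x. f' x v)"
  shows "Ck_on (Suc k) S f"
proof -
  have eq: "f' x = frechet_derivative f (at x)" if "x \<in> S" for x
    using assms(2)[OF that] by (rule frechet_derivative_at)
  have "Ck_on k S (\<lambda>x. frechet_derivative f (at x) v)" for v
    by (rule Ck_on_cong[OF assms(1) _ assms(3)[of v]]) (simp add: eq)
  then show ?thesis using assms(2) by (auto simp: differentiable_def)
qed

lemma Ck_on_SucD: "Ck_on (Suc k) S f \<Longrightarrow> Ck_on k S f"
proof (induction k arbitrary: f)
  case 0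
  then show ?case
    by (auto intro!: continuous_at_imp_continuous_on differentiable_imp_continuous_within)
qed auto

lemma Ck_on_const: "Ck_on k S (\<lambda>x. c)"
proof (induction k arbitrary: c)
  case (Suc k)
  have "frechet_derivative (\<lambda>x::'a. c::'b) (at x) v = 0" for x v
    by (metis frechet_derivative_at has_derivative_const)
  then show ?case using Suc by simp
qed simp

lemma Ck_on_bounded_linear:
  assumes "bounded_linear f"
  shows "Ck_on k S f"
proof (cases k)
  case 0
  then show ?thesis using assms by (simp add: linear_continuous_on)
next
  case (Suc m)
  have "Ck_on (Suc m) UNIV f"
    by (rule Ck_on_SucI[OF open_UNIV bounded_linear_imp_has_derivative[OF assms] Ck_on_const])
  then show ?thesis using Suc Ck_on_subset by blast
qed

lemma Ck_on_add:
  assumes "open S" "Ck_on k S f" "Ck_on k S g"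
  shows "Ck_on k S (\<lambda>x. f x + g x)"
  using assms(2,3)
proof (induction k arbitrary: f g)
  case 0
  then show ?case by (auto intro: continuous_intros)
next
  case (Suc k)
  have "((\<lambda>x. f x + g x) has_derivative
      (\<lambda>v. frechet_derivative f (at x) v + frechet_derivative g (at x) v)) (at x)" if "x \<in> S" for x
    using Suc.prems that by (auto intro!: has_derivative_add simp: frechet_derivative_works[symmetric])
  moreover have "Ck_on k S (\<lambda>x. frechet_derivative f (at x) v + frechet_derivative g (at x) v)" for v
    using Suc by auto
  ultimately show ?case by (rule Ck_on_SucI[OF \<open>open S\<close>])
qed

lemma Ck_on_sum:
  assumes "open S" "\<And>i. i \<in> I \<Longrightarrow> Ck_on k S (f i)"
  shows "Ck_on k S (\<lambda>x. \<Sum>i\<in>I. f i x)"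
  using assms(2) by (induction I rule: infinite_finite_induct) (auto intro: Ck_on_const Ck_on_add[OF assms(1)])

text \<open>The Leibniz rule gives two terms of the same shape, each with one factor
  undifferentiated and so of class \<open>k\<close> by \<open>Ck_on_SucD\<close>. An arbitrary
  bilinear \<open>pr\<close> covers multiplication, scaling and inner products at once.\<close>

lemma Ck_on_bilinear:
  assumes "bounded_bilinear pr" "open S" "Ck_on k S f" "Ck_on k S g"
  shows "Ck_on k S (\<lambda>x. pr (f x) (g x))"
  using assms(3,4)
proof (induction k arbitrary: f g)
  case 0
  then show ?case using bounded_bilinear.continuous_on[OF assms(1)] by auto
next
  case (Suc k)
  have "((\<lambda>x. pr (f x) (g x)) has_derivative (\<lambda>v. pr (f x) (frechet_derivative g (at x) v) +
      pr (frechet_derivative f (at x) v) (g x))) (at x)" if "x \<in> S" for x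
    using Suc.prems that
    by (auto intro!: bounded_bilinear.FDERIV[OF assms(1)] simp: frechet_derivative_works[symmetric])
  moreover have "Ck_on k S (\<lambda>x. pr (f x) (frechet_derivative g (at x) v) +
      pr (frechet_derivative f (at x) v) (g x))" for v
    using Suc.prems Ck_on_SucD[OF Suc.prems(1)] Ck_on_SucD[OF Suc.prems(2)]
    by (intro Ck_on_add[OF \<open>open S\<close>] Suc.IH) simp_all
  ultimately show ?case by (rule Ck_on_SucI[OF \<open>open S\<close>])
qed

lemma linear_basis_expansion:
  fixes F :: "'e::euclidean_space \<Rightarrow> 'f::real_vector"
  assumes "linear F"
  shows "F w = (\<Sum>b\<in>Basis. (w \<bullet> b) *\<^sub>R F b)"
proof -
  have "F (\<Sum>b\<in>Basis. (w \<bullet> b) *\<^sub>R b) = (\<Sum>b\<in>Basis. (w \<bullet> b) *\<^sub>R F b)"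
    by (simp add: linear_sum[OF assms] linear_scale[OF assms])
  then show ?thesis by (simp add: euclidean_representation)
qed

text \<open>\<open>Ck_on\<close> controls derivatives in constant directions only, while the chain
  rule evaluates the derivative of \<open>g\<close> in a direction that moves with \<open>x\<close>.
  Expanding this direction in \<open>Basis\<close> leaves sums of products of maps already under
  control.\<close>

lemma Ck_on_compose:
  fixes f :: "'e::real_normed_vector \<Rightarrow> 'f::euclidean_space" and g :: "'f \<Rightarrow> 'g::real_normed_vector"
  assumes "open S" "open T" "f ` S \<subseteq> T" "Ck_on k S f" "Ck_on k T g"
  shows "Ck_on k S (\<lambda>x. g (f x))"
  using assms(4,5)
proof (induction k arbitrary: g)
  case 0
  then show ?case using assms(3) by (auto intro: continuous_on_compose2)
next
  case (Suc k)
  have "((\<lambda>x. g (f x)) has_derivative (\<lambda>v. \<Sum>b\<in>Basis. (frechet_derivative f (at x) v \<bullet> b) *\<^sub>R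
      frechet_derivative g (at (f x)) b)) (at x)" if "x \<in> S" for x
  proof -
    have "(g has_derivative frechet_derivative g (at (f x))) (at (f x))"
      using Suc.prems assms(3) that by (auto simp: frechet_derivative_works[symmetric])
    moreover have "(f has_derivative frechet_derivative f (at x)) (at x)"
      using Suc.prems that by (auto simp: frechet_derivative_works[symmetric])
    ultimately have comp: "(g \<circ> f has_derivative
        frechet_derivative g (at (f x)) \<circ> frechet_derivative f (at x)) (at x)"
      and lin: "linear (frechet_derivative g (at (f x)))"
      using diff_chain_at has_derivative_linear by blast+
    have "frechet_derivative g (at (f x)) \<circ> frechet_derivative f (at x) =
        (\<lambda>v. \<Sum>b\<in>Basis. (frechet_derivative f (at x) v \<bullet> b) *\<^sub>R frechet_derivative g (at (f x)) b)"
      unfolding o_def by (rule ext) (rule linear_basis_expansion[OF lin])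
    with comp show ?thesis unfolding o_def by (rule has_derivative_eq_rhs)
  qed
  moreover have "Ck_on k S (\<lambda>x. \<Sum>b\<in>Basis. (frechet_derivative f (at x) v \<bullet> b) *\<^sub>R
      frechet_derivative g (at (f x)) b)" for v
  proof (intro Ck_on_sum Ck_on_bilinear[OF bounded_bilinear_scaleR] \<open>open S\<close>)
    fix b :: 'f
    show "Ck_on k S (\<lambda>x. frechet_derivative f (at x) v \<bullet> b)"
      using Suc.prems by (intro Ck_on_bilinear[OF bounded_bilinear_inner] \<open>open S\<close> Ck_on_const) auto
    show "Ck_on k S (\<lambda>x. frechet_derivative g (at (f x)) b)"
      using Suc.prems Ck_on_SucD by (intro Suc.IH) auto
  qed
  ultimately show ?case by (rule Ck_on_SucI[OF \<open>open S\<close>])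
qed

section \<open>Infinitely differentiable maps\<close>

lemma Cinf_on_subset: "Cinf_on S f \<Longrightarrow> T \<subseteq> S \<Longrightarrow> Cinf_on T f"
  using Ck_on_subset unfolding Cinf_on_def by blast

lemma Cinf_on_cong: "open S \<Longrightarrow> (\<And>x. x \<in> S \<Longrightarrow> f x = g x) \<Longrightarrow> Cinf_on S f \<Longrightarrow> Cinf_on S g"
  using Ck_on_cong unfolding Cinf_on_def by blast

lemma Cinf_on_const: "Cinf_on S (\<lambda>x. c)"
  using Ck_on_const unfolding Cinf_on_def by blast

lemma Cinf_on_add: "open S \<Longrightarrow> Cinf_on S f \<Longrightarrow> Cinf_on S g \<Longrightarrow> Cinf_on S (\<lambda>x. f x + g x)"
  using Ck_on_add unfolding Cinf_on_def by blast

lemma Cinf_on_mult: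
  fixes f g :: "_ \<Rightarrow> 'b::real_normed_algebra"
  shows "open S \<Longrightarrow> Cinf_on S f \<Longrightarrow> Cinf_on S g \<Longrightarrow> Cinf_on S (\<lambda>x. f x * g x)"
  using Ck_on_bilinear[OF bounded_bilinear_mult] unfolding Cinf_on_def by blast

lemma Cinf_on_compose:
  fixes f :: "'e::real_normed_vector \<Rightarrow> 'f::euclidean_space"
  shows "open S \<Longrightarrow> open T \<Longrightarrow> f ` S \<subseteq> T \<Longrightarrow> Cinf_on S f \<Longrightarrow> Cinf_on T g \<Longrightarrow> Cinf_on S (\<lambda>x. g (f x))"
  using Ck_on_compose unfolding Cinf_on_def by blast

lemma Cinf_on_bounded_linear: "bounded_linear f \<Longrightarrow> Cinf_on S f"
  using Ck_on_bounded_linear unfolding Cinf_on_def by blast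

lemma Cinf_on_differentiable: "Cinf_on S f \<Longrightarrow> x \<in> S \<Longrightarrow> f differentiable at x"
  unfolding Cinf_on_def using Ck_on.simps(2) by blast

lemma Cinf_on_frechet_derivative: "Cinf_on S f \<Longrightarrow> Cinf_on S (\<lambda>x. frechet_derivative f (at x) v)"
  unfolding Cinf_on_def using Ck_on.simps(2) by blast

lemma Cinf_on_imp_continuous_on: "Cinf_on S f \<Longrightarrow> continuous_on S f"
  unfolding Cinf_on_def using Ck_on.simps(1) by blast

section \<open>Ray integrals and Hadamard's lemma\<close>

text \<open>Each differentiation under the integral sign produces a factor \<open>t\<close> by the
  chain rule. The weight \<open>t ^ m\<close> absorbs it, so the induction closes with
  \<open>h\<close> and \<open>m\<close> both varying.\<close>

lemma Ck_on_ray_integral: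
  fixes h :: "'e::euclidean_space \<Rightarrow> 'f::banach"
  assumes S: "open S" "convex S" "x0 \<in> S" and h: "Cinf_on S h"
  shows "Ck_on k S (\<lambda>x. integral {0..1} (\<lambda>t. t ^ m *\<^sub>R h (x0 + t *\<^sub>R (x - x0))))"
  using h
proof (induction k arbitrary: h m)
  have ray: "x0 + t *\<^sub>R (x - x0) \<in> S" if "x \<in> S" "t \<in> {0..1}" for x t
  proof -
    have "(1 - t) *\<^sub>R x0 + t *\<^sub>R x \<in> S" using S that by (intro convexD) auto
    then show ?thesis by (simp add: algebra_simps)
  qed
  have cont: "continuous_on (S \<times> cbox 0 1) (\<lambda>(x, t). t ^ m *\<^sub>R h (x0 + t *\<^sub>R (x - x0)))"
    if "Cinf_on S h" for h :: "'e \<Rightarrow> 'f" and m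
  proof -
    have "continuous_on (S \<times> cbox 0 (1::real)) (\<lambda>z. h (x0 + snd z *\<^sub>R (fst z - x0)))"
      by (rule continuous_on_compose2[OF Cinf_on_imp_continuous_on[OF that]])
        (auto intro!: continuous_intros ray)
    then show ?thesis by (auto simp: split_beta intro!: continuous_intros)
  qed
  {
    case 0
    then show ?case using integral_continuous_on_param[OF cont[OF 0]] by simp
  next
    case (Suc k)
    \<comment> \<open>\<open>leibniz_rule\<close> wants the derivative as a bounded operator that is
      jointly continuous in \<open>x\<close> and \<open>t\<close>; in finite dimension this
      continuity can be checked one basis vector at a time.\<close>
    define F where "F x t = Blinfun (\<lambda>v. t ^ Suc m *\<^sub>R
      frechet_derivative h (at (x0 + t *\<^sub>R (x - x0))) v)" for x and t :: real
    have hd: "(h has_derivative frechet_derivative h (at (x0 + t *\<^sub>R (x - x0)))) (at (x0 + t *\<^sub>R (x - x0)))"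
      if "x \<in> S" "t \<in> {0..1}" for x t
      using Cinf_on_differentiable[OF Suc.prems ray[OF that]] frechet_derivative_works by blast
    have F: "blinfun_apply (F x t) v =
        t ^ Suc m *\<^sub>R frechet_derivative h (at (x0 + t *\<^sub>R (x - x0))) v"
      if "x \<in> S" "t \<in> {0..1}" for x t v
      unfolding F_def
      by (rule bounded_linear_Blinfun_apply[THEN fun_cong])
        (auto intro!: bounded_linear_const_scaleR has_derivative_bounded_linear[OF hd[OF that]])
    have Fcont: "continuous_on (S \<times> cbox 0 1) (\<lambda>(x, t). F x t)"
    proof (rule continuous_on_blinfun_componentwise)
      fix i :: 'e
      have "continuous_on (S \<times> cbox 0 1)
          (\<lambda>(x, t). t ^ Suc m *\<^sub>R frechet_derivative h (at (x0 + t *\<^sub>R (x - x0))) i)"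
        by (rule cont[OF Cinf_on_frechet_derivative[OF Suc.prems]])
      then show "continuous_on (S \<times> cbox 0 1) (\<lambda>z. blinfun_apply (case z of (x, t) \<Rightarrow> F x t) i)"
        by (rule continuous_on_eq) (use F in auto)
    qed
    have slice: "continuous_on {0..1} (\<lambda>t. G x t)"
      if "continuous_on (S \<times> cbox 0 1) (\<lambda>(x, t). G x t)" "x \<in> S"
      for G :: "'e \<Rightarrow> real \<Rightarrow> 'h::topological_space" and x
    proof -
      have "continuous_on {0..1} (\<lambda>t. case (x, t) of (x, t) \<Rightarrow> G x t)"
        by (rule continuous_on_compose2[OF that(1)]) (use that(2) in \<open>auto intro!: continuous_intros\<close>)
      then show ?thesis by simp
    qed
    have "((\<lambda>x. integral {0..1} (\<lambda>t. t ^ m *\<^sub>R h (x0 + t *\<^sub>R (x - x0)))) has_derivative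
        (\<lambda>v. integral {0..1} (\<lambda>t. t ^ Suc m *\<^sub>R frechet_derivative h (at (x0 + t *\<^sub>R (x - x0))) v))) (at x)"
      if x: "x \<in> S" for x
    proof -
      have "((\<lambda>x. integral (cbox 0 1) (\<lambda>t. t ^ m *\<^sub>R h (x0 + t *\<^sub>R (x - x0)))) has_derivative
        blinfun_apply (integral (cbox 0 1) (F x))) (at x within S)"
      proof (rule leibniz_rule[OF _ _ Fcont x \<open>convex S\<close>])
        fix x t assume xt: "x \<in> S" "t \<in> cbox 0 (1::real)"
        have d: "((\<lambda>x. x0 + t *\<^sub>R (x - x0)) has_derivative (\<lambda>v. t *\<^sub>R v)) (at x)"
          by (auto intro!: derivative_eq_intros)
        have "((\<lambda>x. h (x0 + t *\<^sub>R (x - x0))) has_derivative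
            (\<lambda>v. frechet_derivative h (at (x0 + t *\<^sub>R (x - x0))) (t *\<^sub>R v))) (at x)"
          using diff_chain_at[OF d hd] xt by (simp add: o_def)
        then have "((\<lambda>x. t ^ m *\<^sub>R h (x0 + t *\<^sub>R (x - x0))) has_derivative
            (\<lambda>v. t ^ m *\<^sub>R frechet_derivative h (at (x0 + t *\<^sub>R (x - x0))) (t *\<^sub>R v))) (at x)"
          by (rule has_derivative_scaleR_right)
        moreover have "(\<lambda>v. t ^ m *\<^sub>R frechet_derivative h (at (x0 + t *\<^sub>R (x - x0))) (t *\<^sub>R v)) =
            blinfun_apply (F x t)"
          using F[of x t] xt linear_scale[OF has_derivative_linear[OF hd[of x t]]]
          by (auto simp: fun_eq_iff)
        ultimately show "((\<lambda>x. t ^ m *\<^sub>R h (x0 + t *\<^sub>R (x - x0))) has_derivative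
            blinfun_apply (F x t)) (at x within S)"
          by (metis has_derivative_at_withinI)
      next
        fix x assume "x \<in> S"
        show "(\<lambda>t. t ^ m *\<^sub>R h (x0 + t *\<^sub>R (x - x0))) integrable_on cbox 0 1"
          using slice[OF cont[OF Suc.prems] \<open>x \<in> S\<close>] by (auto intro: integrable_continuous_real)
      qed
      moreover have "blinfun_apply (integral (cbox 0 1) (F x)) v =
          integral {0..1} (\<lambda>t. t ^ Suc m *\<^sub>R frechet_derivative h (at (x0 + t *\<^sub>R (x - x0))) v)" for v
      proof -
        have "F x integrable_on cbox 0 1"
          using slice[OF Fcont x] by (auto intro: integrable_continuous_real)
        from blinfun_apply_integral[OF this, of v] show ?thesis
          using F x by (auto intro!: integral_cong)
      qed
      then have "blinfun_apply (integral (cbox 0 1) (F x)) =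
          (\<lambda>v. integral {0..1} (\<lambda>t. t ^ Suc m *\<^sub>R frechet_derivative h (at (x0 + t *\<^sub>R (x - x0))) v))"
        by (rule ext)
      ultimately show ?thesis
        unfolding at_within_open[OF x S(1)] box_real by (rule has_derivative_eq_rhs)
    qed
    then show ?case
      by (rule Ck_on_SucI[OF S(1) _ Suc.IH[OF Cinf_on_frechet_derivative[OF Suc.prems]]])
  }
qed

text \<open>Integrating the derivative of \<open>f\<close> along the segment from \<open>x0\<close>
  to \<open>x\<close> gives \<open>f x - f x0\<close>, and splitting \<open>x - x0\<close> over
  \<open>Basis\<close> pulls the coordinates out of the integral. Convexity keeps the segment inside
  \<open>S\<close>.\<close>

lemma Hadamard_factorization:
  fixes f :: "'e::euclidean_space \<Rightarrow> 'f::banach"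
  assumes S: "open S" "convex S" "x0 \<in> S" and f: "Cinf_on S f"
  obtains g where "\<And>b. Cinf_on S (g b)" "\<And>b. g b x0 = frechet_derivative f (at x0) b"
    "\<And>x. x \<in> S \<Longrightarrow> f x = f x0 + (\<Sum>b\<in>Basis. ((x - x0) \<bullet> b) *\<^sub>R g b x)"
proof
  define g where "g b x = integral {0..1} (\<lambda>t. frechet_derivative f (at (x0 + t *\<^sub>R (x - x0))) b)" for b x
  show g_smooth: "Cinf_on S (g b)" for b
    unfolding Cinf_on_def g_def
    using Ck_on_ray_integral[OF S Cinf_on_frechet_derivative[OF f, of b], where m = 0] by simp
  show "g b x0 = frechet_derivative f (at x0) b" for b
    by (simp add: g_def)
  fix x assume x: "x \<in> S"
  have ray: "x0 + t *\<^sub>R (x - x0) \<in> S" if "t \<in> {0..1}" for t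
  proof -
    have "(1 - t) *\<^sub>R x0 + t *\<^sub>R x \<in> S" using S that x by (intro convexD) auto
    then show ?thesis by (simp add: algebra_simps)
  qed
  let ?D = "\<lambda>t. frechet_derivative f (at (x0 + t *\<^sub>R (x - x0)))"
  have D: "(f has_derivative ?D t) (at (x0 + t *\<^sub>R (x - x0)))" if "t \<in> {0..1}" for t
    using Cinf_on_differentiable[OF f ray[OF that]] frechet_derivative_works by blast
  have Dsum: "?D t (x - x0) = (\<Sum>b\<in>Basis. ((x - x0) \<bullet> b) *\<^sub>R ?D t b)" if "t \<in> {0..1}" for t
    by (rule linear_basis_expansion[OF has_derivative_linear[OF D[OF that]]])
  have "((\<lambda>t. ?D t (x - x0)) has_integral (f (x0 + 1 *\<^sub>R (x - x0)) - f (x0 + 0 *\<^sub>R (x - x0)))) {0..1}"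
  proof (rule fundamental_theorem_of_calculus)
    fix t :: real assume t: "t \<in> {0..1}"
    have "((\<lambda>t. x0 + t *\<^sub>R (x - x0)) has_derivative (\<lambda>s. s *\<^sub>R (x - x0))) (at t)"
      by (auto intro!: derivative_eq_intros)
    from diff_chain_at[OF this D[OF t]]
    have "((\<lambda>t. f (x0 + t *\<^sub>R (x - x0))) has_derivative (\<lambda>s. ?D t (s *\<^sub>R (x - x0)))) (at t)"
      by (simp add: o_def)
    then show "((\<lambda>t. f (x0 + t *\<^sub>R (x - x0))) has_vector_derivative ?D t (x - x0)) (at t within {0..1})"
      unfolding has_vector_derivative_def
      by (simp add: linear_scale[OF has_derivative_linear[OF D[OF t]]] has_derivative_at_withinI)
  qed simp
  then have "f x - f x0 = integral {0..1} (\<lambda>t. ?D t (x - x0))"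
    by (simp add: integral_unique)
  also have "\<dots> = integral {0..1} (\<lambda>t. \<Sum>b\<in>Basis. ((x - x0) \<bullet> b) *\<^sub>R ?D t b)"
    by (rule integral_cong) (use Dsum in auto)
  also have "\<dots> = (\<Sum>b\<in>Basis. integral {0..1} (\<lambda>t. ((x - x0) \<bullet> b) *\<^sub>R ?D t b))"
  proof (rule integral_sum)
    fix b :: 'e assume "b \<in> Basis"
    have "continuous_on {0..1} (\<lambda>t. ?D t b)"
      by (rule continuous_on_compose2[OF Cinf_on_imp_continuous_on[OF Cinf_on_frechet_derivative[OF f, of b]]])
        (auto intro!: continuous_intros ray)
    then show "(\<lambda>t. ((x - x0) \<bullet> b) *\<^sub>R ?D t b) integrable_on {0..1}"
      by (auto intro!: integrable_continuous_real continuous_intros)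
  qed simp
  also have "\<dots> = (\<Sum>b\<in>Basis. ((x - x0) \<bullet> b) *\<^sub>R g b x)"
    by (simp add: g_def)
  finally show "f x = f x0 + (\<Sum>b\<in>Basis. ((x - x0) \<bullet> b) *\<^sub>R g b x)"
    by (metis add.commute diff_add_cancel)
qed

section \<open>Derivations and coordinates\<close>

lemma smooth_fun_subset:
  assumes "smooth_fun \<A> W f" "W' \<subseteq> W"
  shows "smooth_fun \<A> W' f"
  unfolding smooth_fun_def
proof clarify
  fix U \<phi> assume "(U, \<phi>) \<in> \<A>"
  then have "Cinf_on (\<phi> ` (U \<inter> W)) (f \<circ> inv_into U \<phi>)"
    using assms(1) unfolding smooth_fun_def by blast
  then show "Cinf_on (\<phi> ` (U \<inter> W')) (f \<circ> inv_into U \<phi>)"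
    by (rule Cinf_on_subset) (use assms(2) in blast)
qed

lemma smooth_near_of_smooth_fun: "open W \<Longrightarrow> p \<in> W \<Longrightarrow> smooth_fun \<A> W f \<Longrightarrow> smooth_near \<A> p f"
  unfolding smooth_near_def by blast

locale smooth_manifold =
  fixes \<A> :: "('a::{t2_space,second_countable_topology}, 'e::euclidean_space) atlas"
  assumes smooth_atlas: "smooth_atlas \<A>"
begin

lemma chart_at: obtains U \<phi> where "(U, \<phi>) \<in> \<A>" "p \<in> U"
proof -
  have "p \<in> (\<Union>(U, \<phi>)\<in>\<A>. U)"
    using smooth_atlas unfolding smooth_atlas_def by simp
  then show ?thesis using that by auto
qed

lemma
  assumes "(U, \<phi>) \<in> \<A>"
  shows chart_open: "open U"
    and chart_range_open: "open (\<phi> ` U)"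
    and chart_homeomorphism: "homeomorphism U (\<phi> ` U) \<phi> (inv_into U \<phi>)"
proof -
  have "\<forall>(U, \<phi>)\<in>\<A>. open U \<and> open (\<phi> ` U) \<and> homeomorphism U (\<phi> ` U) \<phi> (inv_into U \<phi>)"
    using smooth_atlas unfolding smooth_atlas_def by (elim conjE)
  from bspec[OF this assms] show "open U" "open (\<phi> ` U)" "homeomorphism U (\<phi> ` U) \<phi> (inv_into U \<phi>)"
    by simp_all
qed

lemma chart_inverse: "(U, \<phi>) \<in> \<A> \<Longrightarrow> p \<in> U \<Longrightarrow> inv_into U \<phi> (\<phi> p) = p"
  using chart_homeomorphism unfolding homeomorphism_def by blast

lemma chart_continuous: "(U, \<phi>) \<in> \<A> \<Longrightarrow> continuous_on U \<phi>"
  using chart_homeomorphism unfolding homeomorphism_def by blast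

lemma chart_image_open:
  assumes "(U, \<phi>) \<in> \<A>" "open W"
  shows "open (\<phi> ` (U \<inter> W))"
proof -
  have "openin (top_of_set (\<phi> ` U)) (\<phi> ` (U \<inter> W))"
    using homeomorphism_imp_open_map[OF chart_homeomorphism[OF assms(1)]] assms(2) by blast
  then show ?thesis by (simp add: openin_open_eq chart_range_open[OF assms(1)])
qed

lemma transition_smooth:
  assumes "(U, \<phi>) \<in> \<A>" "(V, \<psi>) \<in> \<A>"
  shows "Cinf_on (\<phi> ` (U \<inter> V)) (\<psi> \<circ> inv_into U \<phi>)"
proof -
  have "\<forall>(U, \<phi>)\<in>\<A>. \<forall>(V, \<psi>)\<in>\<A>. Cinf_on (\<phi> ` (U \<inter> V)) (\<psi> \<circ> inv_into U \<phi>)"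
    using smooth_atlas unfolding smooth_atlas_def by (elim conjE)
  from bspec[OF bspec[OF this assms(1), unfolded prod.case] assms(2)] show ?thesis by simp
qed

section \<open>Algebra of smooth functions and smooth germs\<close>

lemma smooth_funI:
  assumes "\<And>U \<phi>. (U, \<phi>) \<in> \<A> \<Longrightarrow> Cinf_on (\<phi> ` (U \<inter> W)) (\<lambda>y. f (inv_into U \<phi> y))"
  shows "smooth_fun \<A> W f"
  using assms unfolding smooth_fun_def o_def by auto

lemma smooth_funD:
  "smooth_fun \<A> W f \<Longrightarrow> (U, \<phi>) \<in> \<A> \<Longrightarrow> Cinf_on (\<phi> ` (U \<inter> W)) (\<lambda>y. f (inv_into U \<phi> y))"
  unfolding smooth_fun_def o_def by auto

lemma smooth_fun_const: "smooth_fun \<A> W (\<lambda>q. c)"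
  by (rule smooth_funI) (rule Cinf_on_const)

lemma smooth_fun_add:
  "open W \<Longrightarrow> smooth_fun \<A> W f \<Longrightarrow> smooth_fun \<A> W g \<Longrightarrow> smooth_fun \<A> W (\<lambda>q. f q + g q)"
  by (rule smooth_funI) (rule Cinf_on_add[OF chart_image_open smooth_funD[of W f] smooth_funD[of W g]])

lemma smooth_fun_mult:
  "open W \<Longrightarrow> smooth_fun \<A> W f \<Longrightarrow> smooth_fun \<A> W g \<Longrightarrow> smooth_fun \<A> W (\<lambda>q. f q * g q)"
  by (rule smooth_funI) (rule Cinf_on_mult[OF chart_image_open smooth_funD[of W f] smooth_funD[of W g]])

lemma smooth_fun_minus:
  assumes "open W" "smooth_fun \<A> W f"
  shows "smooth_fun \<A> W (\<lambda>q. - f q)"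
  using smooth_fun_mult[OF assms(1) smooth_fun_const assms(2), of "-1"] by simp

lemma smooth_fun_diff:
  "open W \<Longrightarrow> smooth_fun \<A> W f \<Longrightarrow> smooth_fun \<A> W g \<Longrightarrow> smooth_fun \<A> W (\<lambda>q. f q - g q)"
  using smooth_fun_add[of W f "\<lambda>q. - g q"] smooth_fun_minus by simp

lemma smooth_fun_sum:
  assumes "open W" "\<And>k. k \<in> K \<Longrightarrow> smooth_fun \<A> W (f k)"
  shows "smooth_fun \<A> W (\<lambda>q. \<Sum>k\<in>K. f k q)"
  using assms(2)
  by (induction K rule: infinite_finite_induct) (auto intro: smooth_fun_const smooth_fun_add assms(1))

lemma smooth_fun_cong:
  assumes "open W" "\<And>q. q \<in> W \<Longrightarrow> f q = g q" "smooth_fun \<A> W f"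
  shows "smooth_fun \<A> W g"
proof (rule smooth_funI)
  fix U \<phi> assume c: "(U, \<phi>) \<in> \<A>"
  show "Cinf_on (\<phi> ` (U \<inter> W)) (\<lambda>y. g (inv_into U \<phi> y))"
    by (rule Cinf_on_cong[OF chart_image_open[OF c assms(1)] _ smooth_funD[OF assms(3) c]])
      (auto simp: chart_inverse[OF c] assms(2))
qed

text \<open>Smoothness has to be tested in every chart; seen from another chart the function is
  \<open>g\<close> after a transition map.\<close>

lemma smooth_fun_chart_compose:
  assumes c: "(U, \<phi>) \<in> \<A>" and W: "open W" "W \<subseteq> U" and T: "open T" "\<phi> ` W \<subseteq> T" "Cinf_on T g"
  shows "smooth_fun \<A> W (\<lambda>q. g (\<phi> q))"
proof (rule smooth_funI)
  fix V \<psi> assume d: "(V, \<psi>) \<in> \<A>"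
  have tr: "Cinf_on (\<psi> ` (V \<inter> W)) (\<lambda>y. \<phi> (inv_into V \<psi> y))"
    by (rule Cinf_on_subset[OF transition_smooth[OF d c, unfolded o_def]]) (use W in auto)
  show "Cinf_on (\<psi> ` (V \<inter> W)) (\<lambda>y. g (\<phi> (inv_into V \<psi> y)))"
    by (rule Cinf_on_compose[OF chart_image_open[OF d W(1)] T(1) _ tr T(3)])
      (use T(2) chart_inverse[OF d] in auto)
qed

lemma smooth_near_obtain2:
  assumes "smooth_near \<A> p f" "smooth_near \<A> p g"
  obtains W where "open W" "p \<in> W" "smooth_fun \<A> W f" "smooth_fun \<A> W g"
proof -
  obtain V V' where "open V" "p \<in> V" "smooth_fun \<A> V f" "open V'" "p \<in> V'" "smooth_fun \<A> V' g"
    using assms unfolding smooth_near_def by blast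
  then show ?thesis
    by (intro that[of "V \<inter> V'"]) (auto intro: smooth_fun_subset)
qed

lemma smooth_near_const: "smooth_near \<A> p (\<lambda>q. c)"
  by (rule smooth_near_of_smooth_fun[OF open_UNIV UNIV_I smooth_fun_const])

lemma smooth_near_add: "smooth_near \<A> p f \<Longrightarrow> smooth_near \<A> p g \<Longrightarrow> smooth_near \<A> p (\<lambda>q. f q + g q)"
  by (erule (1) smooth_near_obtain2) (rule smooth_near_of_smooth_fun[OF _ _ smooth_fun_add])

lemma smooth_near_mult: "smooth_near \<A> p f \<Longrightarrow> smooth_near \<A> p g \<Longrightarrow> smooth_near \<A> p (\<lambda>q. f q * g q)"
  by (erule (1) smooth_near_obtain2) (rule smooth_near_of_smooth_fun[OF _ _ smooth_fun_mult])

lemma smooth_near_sum: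
  assumes "\<And>k. k \<in> K \<Longrightarrow> smooth_near \<A> p (f k)"
  shows "smooth_near \<A> p (\<lambda>q. \<Sum>k\<in>K. f k q)"
  using assms
  by (induction K rule: infinite_finite_induct) (auto intro: smooth_near_const smooth_near_add)

lemma smooth_near_eventually: "smooth_near \<A> p f \<Longrightarrow> \<forall>\<^sub>F q in nhds p. smooth_near \<A> q f"
  unfolding smooth_near_def eventually_nhds by blast

lemma smooth_near_cong:
  assumes "\<forall>\<^sub>F q in nhds p. f q = g q" "smooth_near \<A> p f"
  shows "smooth_near \<A> p g"
proof -
  obtain V where V: "open V" "p \<in> V" "\<And>q. q \<in> V \<Longrightarrow> f q = g q"
    using assms(1) unfolding eventually_nhds by blast
  obtain W where W: "open W" "p \<in> W" "smooth_fun \<A> W f"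
    using assms(2) unfolding smooth_near_def by blast
  have "smooth_fun \<A> (V \<inter> W) g"
    by (rule smooth_fun_cong[of _ f]) (use V W in \<open>auto intro: smooth_fun_subset\<close>)
  then show ?thesis using V W by (intro smooth_near_of_smooth_fun[of "V \<inter> W"]) auto
qed

section \<open>Derivations of germs\<close>

lemma tangent_add:
  "D \<in> tangent_space \<A> p \<Longrightarrow> smooth_near \<A> p f \<Longrightarrow> smooth_near \<A> p g \<Longrightarrow>
    D (\<lambda>q. f q + g q) = D f + D g"
  unfolding tangent_space_def by simp

lemma tangent_mult:
  "D \<in> tangent_space \<A> p \<Longrightarrow> smooth_near \<A> p f \<Longrightarrow> smooth_near \<A> p g \<Longrightarrow>
    D (\<lambda>q. f q * g q) = D f * g p + f p * D g"
  unfolding tangent_space_def by simp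

lemma tangent_scale:
  "D \<in> tangent_space \<A> p \<Longrightarrow> smooth_near \<A> p f \<Longrightarrow> D (\<lambda>q. c * f q) = c * D f"
  unfolding tangent_space_def by simp

text \<open>Locality is part of the definition for smooth germs. For other functions both sides are
  the default \<open>0\<close>, since smoothness near \<open>p\<close> depends only on the
  germ.\<close>

lemma tangent_cong:
  assumes "D \<in> tangent_space \<A> p" "\<forall>\<^sub>F q in nhds p. f q = g q"
  shows "D f = D g"
proof (cases "smooth_near \<A> p f")
  case True
  then show ?thesis using assms smooth_near_cong[OF assms(2)] unfolding tangent_space_def by simp
next
  case False
  moreover have "\<not> smooth_near \<A> p g"
    using False smooth_near_cong[where f = g and g = f and p = p] assms(2) by (auto simp: eq_commute)
  ultimately show ?thesis using assms(1) unfolding tangent_space_def by simp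
qed

lemma tangent_not_smooth: "D \<in> tangent_space \<A> p \<Longrightarrow> \<not> smooth_near \<A> p f \<Longrightarrow> D f = 0"
  unfolding tangent_space_def by simp

lemma tangent_const:
  assumes "D \<in> tangent_space \<A> p"
  shows "D (\<lambda>q. c) = 0"
proof -
  \<comment> \<open>The product rule for \<open>1 = 1 * 1\<close> gives
    \<open>D 1 = D 1 + D 1\<close>.\<close>
  have "D (\<lambda>q. 1) = 0"
    using tangent_mult[OF assms smooth_near_const smooth_near_const, of 1 1] by simp
  then show ?thesis
    using tangent_scale[OF assms smooth_near_const, of c 1] by simp
qed

lemma tangent_diff:
  assumes "D \<in> tangent_space \<A> p" "smooth_near \<A> p f" "smooth_near \<A> p g"
  shows "D (\<lambda>q. f q - g q) = D f - D g"
  using tangent_add[OF assms(1,2) smooth_near_mult[OF smooth_near_const[of p "-1"] assms(3)]]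
    tangent_scale[OF assms(1,3), of "-1"] by simp

lemma tangent_sum:
  assumes "D \<in> tangent_space \<A> p" "\<And>k. k \<in> K \<Longrightarrow> smooth_near \<A> p (f k)"
  shows "D (\<lambda>q. \<Sum>k\<in>K. f k q) = (\<Sum>k\<in>K. D (f k))"
  using assms(2)
proof (induction K rule: infinite_finite_induct)
  case (insert k K)
  then show ?case
    by (simp add: tangent_add[OF assms(1)] smooth_near_sum)
qed (simp_all add: tangent_const[OF assms(1)])

lemma tangent_lincomb:
  assumes "\<And>k. k \<in> K \<Longrightarrow> E k \<in> tangent_space \<A> p"
  shows "(\<lambda>f. \<Sum>k\<in>K. c k * E k f) \<in> tangent_space \<A> p"
proof -
  have "(\<Sum>k\<in>K. c k * E k f) = (\<Sum>k\<in>K. c k * E k g)" if "\<forall>\<^sub>F q in nhds p. f q = g q" for f g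
    using tangent_cong[OF assms that] by simp
  then show ?thesis
    unfolding tangent_space_def
    by (simp add: tangent_add[OF assms] tangent_mult[OF assms] tangent_scale[OF assms]
        tangent_not_smooth[OF assms] algebra_simps sum.distrib sum_distrib_left)
qed

section \<open>Coordinate functions and coordinate fields\<close>

definition coord :: "('a \<Rightarrow> 'e) \<Rightarrow> 'e \<Rightarrow> 'a \<Rightarrow> complex" where
  "coord \<phi> b q = complex_of_real (\<phi> q \<bullet> b)"

lemma smooth_fun_coord:
  assumes "(U, \<phi>) \<in> \<A>"
  shows "smooth_fun \<A> U (coord \<phi> b)"
proof -
  have "bounded_linear (\<lambda>x. complex_of_real (x \<bullet> b))"
    by (rule bounded_linear_compose[OF bounded_linear_of_real bounded_linear_inner_left])
  from smooth_fun_chart_compose[OF assms chart_open[OF assms] _ open_UNIV _ Cinf_on_bounded_linear[OF this]]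
  show ?thesis unfolding coord_def by simp
qed

lemma smooth_near_coord: "(U, \<phi>) \<in> \<A> \<Longrightarrow> p \<in> U \<Longrightarrow> smooth_near \<A> p (coord \<phi> b)"
  by (rule smooth_near_of_smooth_fun[OF chart_open _ smooth_fun_coord])

text \<open>In Hadamard's formula every summand of \<open>f - f p\<close> is a product whose first
  factor, a centred coordinate, vanishes at \<open>p\<close>; the product rule therefore leaves only
  the derivative of that coordinate times \<open>g b (\<phi> p)\<close>.\<close>

lemma tangent_coord_expansion:
  assumes c: "(U, \<phi>) \<in> \<A>" and p: "p \<in> U" and D: "D \<in> tangent_space \<A> p" and f: "smooth_near \<A> p f"
  shows "D f = (\<Sum>b\<in>Basis. D (coord \<phi> b) * frechet_derivative (f \<circ> inv_into U \<phi>) (at (\<phi> p)) b)"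
proof -
  obtain W where W: "open W" "p \<in> W" "smooth_fun \<A> W f"
    using f unfolding smooth_near_def by blast
  have "\<phi> p \<in> \<phi> ` (U \<inter> W)" using p W by auto
  then obtain r where r: "r > 0" "ball (\<phi> p) r \<subseteq> \<phi> ` (U \<inter> W)"
    using chart_image_open[OF c W(1)] open_contains_ball by blast
  have "Cinf_on (ball (\<phi> p) r) (f \<circ> inv_into U \<phi>)"
    using smooth_funD[OF W(3) c] r(2) unfolding o_def by (rule Cinf_on_subset)
  then obtain g where g: "\<And>b. Cinf_on (ball (\<phi> p) r) (g b)"
      "\<And>b. g b (\<phi> p) = frechet_derivative (f \<circ> inv_into U \<phi>) (at (\<phi> p)) b"
      "\<And>x. x \<in> ball (\<phi> p) r \<Longrightarrow> (f \<circ> inv_into U \<phi>) x =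
        (f \<circ> inv_into U \<phi>) (\<phi> p) + (\<Sum>b\<in>Basis. ((x - \<phi> p) \<bullet> b) *\<^sub>R g b x)"
    using Hadamard_factorization[of "ball (\<phi> p) r" "\<phi> p" "f \<circ> inv_into U \<phi>"] r(1) by auto
  \<comment> \<open>The factors \<open>g b\<close> are controlled only on a ball in the chart. Its
    preimage is a neighbourhood of \<open>p\<close> on which the factorization pulls back.\<close>
  define V where "V = U \<inter> \<phi> -` ball (\<phi> p) r"
  have V: "open V" "V \<subseteq> U" "p \<in> V" "\<phi> ` V \<subseteq> ball (\<phi> p) r"
    using continuous_open_preimage[OF chart_continuous[OF c] chart_open[OF c] open_ball] p r(1)
    unfolding V_def by auto
  have gs: "smooth_near \<A> p (\<lambda>q. g b (\<phi> q))" for b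
    by (rule smooth_near_of_smooth_fun[OF V(1,3)])
      (rule smooth_fun_chart_compose[OF c V(1,2) open_ball V(4) g(1)])
  note cs = smooth_near_coord[OF c p]
  have xs: "smooth_near \<A> p (\<lambda>q. coord \<phi> b q - coord \<phi> b p)" for b
    using smooth_near_add[OF cs smooth_near_const, of b "- coord \<phi> b p"] by simp
  have "\<forall>q\<in>V. f q = f p + (\<Sum>b\<in>Basis. (coord \<phi> b q - coord \<phi> b p) * g b (\<phi> q))"
  proof
    fix q assume q: "q \<in> V"
    then have "inv_into U \<phi> (\<phi> q) = q" "\<phi> q \<in> ball (\<phi> p) r"
      using V chart_inverse[OF c] by blast+
    then show "f q = f p + (\<Sum>b\<in>Basis. (coord \<phi> b q - coord \<phi> b p) * g b (\<phi> q))"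
      using g(3)[of "\<phi> q"] chart_inverse[OF c p]
      by (simp add: coord_def scaleR_conv_of_real inner_diff_left)
  qed
  then have "\<forall>\<^sub>F q in nhds p. f q = f p + (\<Sum>b\<in>Basis. (coord \<phi> b q - coord \<phi> b p) * g b (\<phi> q))"
    using V(1,3) unfolding eventually_nhds by (intro exI[of _ V] conjI)
  then have "D f = D (\<lambda>q. f p + (\<Sum>b\<in>Basis. (coord \<phi> b q - coord \<phi> b p) * g b (\<phi> q)))"
    by (rule tangent_cong[OF D])
  also have "\<dots> = (\<Sum>b\<in>Basis. D (\<lambda>q. (coord \<phi> b q - coord \<phi> b p) * g b (\<phi> q)))"
    by (subst tangent_add[OF D smooth_near_const smooth_near_sum[OF smooth_near_mult[OF xs gs]]])
      (simp add: tangent_const[OF D] tangent_sum[OF D smooth_near_mult[OF xs gs]])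
  also have "\<dots> = (\<Sum>b\<in>Basis. D (coord \<phi> b) * g b (\<phi> p))"
    by (simp add: tangent_mult[OF D xs gs] tangent_diff[OF D cs smooth_near_const] tangent_const[OF D])
  finally show ?thesis by (simp add: g(2))
qed

text \<open>A derivation of germs is a functional on all functions, so \<open>\<partial>/\<partial>x\<^sub>b\<close> must be cut off to \<open>0\<close>
  on functions that are not smooth near the point.\<close>

definition coord_field :: "'a set \<Rightarrow> ('a \<Rightarrow> 'e) \<Rightarrow> 'e \<Rightarrow> 'a vfield" where
  "coord_field U \<phi> b p f = (if smooth_near \<A> p f
     then frechet_derivative (f \<circ> inv_into U \<phi>) (at (\<phi> p)) b else 0)"

lemma smooth_near_has_derivative:
  assumes "(U, \<phi>) \<in> \<A>" "p \<in> U" "smooth_near \<A> p f"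
  shows "(f \<circ> inv_into U \<phi> has_derivative frechet_derivative (f \<circ> inv_into U \<phi>) (at (\<phi> p))) (at (\<phi> p))"
proof -
  obtain W where "open W" "p \<in> W" "smooth_fun \<A> W f"
    using assms(3) unfolding smooth_near_def by blast
  with assms have "f \<circ> inv_into U \<phi> differentiable at (\<phi> p)"
    using Cinf_on_differentiable[OF smooth_funD[OF _ assms(1), of W f], of "\<phi> p"] by (auto simp: o_def)
  then show ?thesis by (simp add: frechet_derivative_works)
qed

lemma coord_field_tangent:
  assumes c: "(U, \<phi>) \<in> \<A>" and p: "p \<in> U"
  shows "coord_field U \<phi> b p \<in> tangent_space \<A> p"
proof -
  note hd = smooth_near_has_derivative[OF c p]
  have "frechet_derivative ((\<lambda>q. f q + g q) \<circ> inv_into U \<phi>) (at (\<phi> p)) b =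
      frechet_derivative (f \<circ> inv_into U \<phi>) (at (\<phi> p)) b + frechet_derivative (g \<circ> inv_into U \<phi>) (at (\<phi> p)) b"
    if "smooth_near \<A> p f" "smooth_near \<A> p g" for f g
    using frechet_derivative_at[OF has_derivative_add[OF hd[OF that(1)] hd[OF that(2)]]]
    by (simp add: o_def fun_eq_iff)
  moreover have "frechet_derivative ((\<lambda>q. f q * g q) \<circ> inv_into U \<phi>) (at (\<phi> p)) b =
      frechet_derivative (f \<circ> inv_into U \<phi>) (at (\<phi> p)) b * g p +
      f p * frechet_derivative (g \<circ> inv_into U \<phi>) (at (\<phi> p)) b"
    if "smooth_near \<A> p f" "smooth_near \<A> p g" for f g
    using frechet_derivative_at[OF has_derivative_mult[OF hd[OF that(1)] hd[OF that(2)]]] chart_inverse[OF c p]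
    by (simp add: o_def fun_eq_iff add.commute)
  moreover have "frechet_derivative ((\<lambda>q. k * f q) \<circ> inv_into U \<phi>) (at (\<phi> p)) b =
      k * frechet_derivative (f \<circ> inv_into U \<phi>) (at (\<phi> p)) b" if "smooth_near \<A> p f" for f k
    using frechet_derivative_at[OF has_derivative_mult_right[OF hd[OF that]], of k]
    by (simp add: o_def fun_eq_iff)
  moreover have "frechet_derivative (f \<circ> inv_into U \<phi>) (at (\<phi> p)) b =
      frechet_derivative (g \<circ> inv_into U \<phi>) (at (\<phi> p)) b"
    if "smooth_near \<A> p f" and ev: "\<forall>\<^sub>F q in nhds p. f q = g q" for f g
  proof -
    obtain W where W: "open W" "p \<in> W" "\<And>q. q \<in> W \<Longrightarrow> f q = g q"
      using ev unfolding eventually_nhds by blast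
    have "frechet_derivative (f \<circ> inv_into U \<phi>) (at (\<phi> p)) = frechet_derivative (g \<circ> inv_into U \<phi>) (at (\<phi> p))"
      by (rule frechet_derivative_transform_within_open[OF _ chart_image_open[OF c W(1)]])
        (use hd[OF that(1)] W p chart_inverse[OF c] in \<open>auto simp: differentiable_def\<close>)
    then show ?thesis by simp
  qed
  ultimately show ?thesis
    unfolding tangent_space_def coord_field_def
    by (auto simp: smooth_near_add smooth_near_mult smooth_near_const)
qed

lemma coord_field_vector_field:
  assumes c: "(U, \<phi>) \<in> \<A>"
  shows "vector_field_on \<A> U (coord_field U \<phi> b)"
  unfolding vector_field_on_def
proof (intro conjI ballI allI impI)
  fix W f assume W: "open W \<and> W \<subseteq> U \<and> smooth_fun \<A> W f"
  have UW: "U \<inter> W = W" using W by blast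
  have "smooth_fun \<A> W (\<lambda>q. frechet_derivative (\<lambda>y. f (inv_into U \<phi> y)) (at (\<phi> q)) b)"
    using W c chart_image_open[OF c, of W] Cinf_on_frechet_derivative[OF smooth_funD[of W f, OF _ c], of b]
    by (intro smooth_fun_chart_compose[where T = "\<phi> ` (U \<inter> W)"]) (auto simp: UW)
  then show "smooth_fun \<A> W (\<lambda>q. coord_field U \<phi> b q f)"
    by (rule smooth_fun_cong[rotated 2])
      (use W in \<open>auto simp: coord_field_def o_def intro: smooth_near_of_smooth_fun\<close>)
qed (rule coord_field_tangent[OF c])

lemma tangent_coord_field_expansion:
  assumes "(U, \<phi>) \<in> \<A>" "p \<in> U" "D \<in> tangent_space \<A> p"
  shows "D = (\<lambda>f. \<Sum>b\<in>Basis. D (coord \<phi> b) * coord_field U \<phi> b p f)"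
proof
  fix f show "D f = (\<Sum>b\<in>Basis. D (coord \<phi> b) * coord_field U \<phi> b p f)"
    using tangent_coord_expansion[OF assms] tangent_not_smooth[OF assms(3)]
    by (cases "smooth_near \<A> p f") (simp_all add: coord_field_def)
qed


section \<open>Vector fields and brackets\<close>

lemma vector_field_tangent: "vector_field_on \<A> U X \<Longrightarrow> p \<in> U \<Longrightarrow> X p \<in> tangent_space \<A> p"
  unfolding vector_field_on_def by blast

lemma vector_field_smooth:
  "vector_field_on \<A> U X \<Longrightarrow> open W \<Longrightarrow> W \<subseteq> U \<Longrightarrow> smooth_fun \<A> W f \<Longrightarrow> smooth_fun \<A> W (\<lambda>q. X q f)"
  unfolding vector_field_on_def by blast

lemma vector_field_smooth_near:
  assumes "vector_field_on \<A> U X" "open U" "p \<in> U" "smooth_near \<A> p f"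
  shows "smooth_near \<A> p (\<lambda>q. X q f)"
proof -
  obtain W where W: "open W" "p \<in> W" "smooth_fun \<A> W f"
    using assms(4) unfolding smooth_near_def by blast
  have "smooth_fun \<A> (U \<inter> W) (\<lambda>q. X q f)"
    by (rule vector_field_smooth[OF assms(1)])
      (use assms W in \<open>auto intro: smooth_fun_subset\<close>)
  then show ?thesis
    using assms W by (intro smooth_near_of_smooth_fun[of "U \<inter> W"]) auto
qed

text \<open>A composite \<open>D(E f)\<close> violates the product rule by the mixed terms
  \<open>E f * D g + D f * E g\<close>; these are symmetric in the two fields and cancel in the
  commutator.\<close>

lemma bracket_tangent:
  assumes X: "vector_field_on \<A> U X" and Y: "vector_field_on \<A> U Y" and U: "open U" "p \<in> U"
  shows "bracket \<A> X Y p \<in> tangent_space \<A> p"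
proof -
  note XT = vector_field_tangent[OF X U(2)] and YT = vector_field_tangent[OF Y U(2)]
  note Xs = vector_field_smooth_near[OF X U] and Ys = vector_field_smooth_near[OF Y U]
  have comp: "D (\<lambda>q. E q (\<lambda>x. f x + g x)) = D (\<lambda>q. E q f) + D (\<lambda>q. E q g)"
      "D (\<lambda>q. E q (\<lambda>x. f x * g x)) =
        D (\<lambda>q. E q f) * g p + E p f * D g + (D f * E p g + f p * D (\<lambda>q. E q g))"
      "D (\<lambda>q. E q (\<lambda>x. c * f x)) = c * D (\<lambda>q. E q f)"
    if E: "vector_field_on \<A> U E" and D: "D \<in> tangent_space \<A> p"
      and f: "smooth_near \<A> p f" and g: "smooth_near \<A> p g" for D E f g c
  proof -
    note s = vector_field_smooth_near[OF E U]
    \<comment> \<open>The rules for \<open>E q\<close> need arguments smooth near \<open>q\<close>,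
      which holds for all \<open>q\<close> close to \<open>p\<close>; this is enough because
      \<open>D\<close> sees only the germ at \<open>p\<close>.\<close>
    have ev: "\<forall>\<^sub>F q in nhds p. q \<in> U \<and> smooth_near \<A> q f \<and> smooth_near \<A> q g"
      using U smooth_near_eventually[OF f] smooth_near_eventually[OF g]
      by (auto simp: eventually_conj_iff eventually_nhds)
    have "D (\<lambda>q. E q (\<lambda>x. f x + g x)) = D (\<lambda>q. E q f + E q g)"
      by (rule tangent_cong[OF D eventually_mono[OF ev]])
        (auto intro: tangent_add vector_field_tangent[OF E])
    then show "D (\<lambda>q. E q (\<lambda>x. f x + g x)) = D (\<lambda>q. E q f) + D (\<lambda>q. E q g)"
      by (simp add: tangent_add[OF D s[OF f] s[OF g]])
    have "D (\<lambda>q. E q (\<lambda>x. f x * g x)) = D (\<lambda>q. E q f * g q + f q * E q g)"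
      by (rule tangent_cong[OF D eventually_mono[OF ev]])
        (auto intro: tangent_mult vector_field_tangent[OF E])
    then show "D (\<lambda>q. E q (\<lambda>x. f x * g x)) =
        D (\<lambda>q. E q f) * g p + E p f * D g + (D f * E p g + f p * D (\<lambda>q. E q g))"
      by (simp add: tangent_add[OF D smooth_near_mult[OF s[OF f] g] smooth_near_mult[OF f s[OF g]]]
          tangent_mult[OF D s[OF f] g] tangent_mult[OF D f s[OF g]])
    have "D (\<lambda>q. E q (\<lambda>x. c * f x)) = D (\<lambda>q. c * E q f)"
      by (rule tangent_cong[OF D eventually_mono[OF ev]])
        (auto intro: tangent_scale vector_field_tangent[OF E])
    then show "D (\<lambda>q. E q (\<lambda>x. c * f x)) = c * D (\<lambda>q. E q f)"
      by (simp add: tangent_scale[OF D s[OF f]])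
  qed
  \<comment> \<open>Functions that agree near \<open>p\<close> also agree near every
    \<open>q\<close> close to \<open>p\<close>, so their derivatives along \<open>E\<close> agree on
    a whole neighbourhood of \<open>p\<close>.\<close>
  have loc: "D (\<lambda>q. E q f) = D (\<lambda>q. E q g)"
    if E: "vector_field_on \<A> U E" and D: "D \<in> tangent_space \<A> p"
      and ev: "\<forall>\<^sub>F q in nhds p. f q = g q" for D E f g
  proof -
    have "\<forall>\<^sub>F q in nhds p. q \<in> U" using U eventually_nhds by blast
    moreover have "\<forall>\<^sub>F q in nhds p. \<forall>\<^sub>F x in nhds q. f x = g x"
      using ev by (simp add: eventually_eventually)
    ultimately have "\<forall>\<^sub>F q in nhds p. E q f = E q g"
      by eventually_elim (rule tangent_cong[OF vector_field_tangent[OF E]])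
    then show ?thesis by (rule tangent_cong[OF D])
  qed
  have "bracket \<A> X Y p f = bracket \<A> X Y p g"
    if "smooth_near \<A> p f" "smooth_near \<A> p g" "\<forall>\<^sub>F q in nhds p. f q = g q" for f g
    using that loc[OF X YT that(3)] loc[OF Y XT that(3)] by (simp add: bracket_def)
  moreover have "bracket \<A> X Y p (\<lambda>x. c * f x) = c * bracket \<A> X Y p f" if f: "smooth_near \<A> p f" for c f
    using f comp(3)[OF X YT f f, of c] comp(3)[OF Y XT f f, of c]
    by (simp add: bracket_def smooth_near_mult smooth_near_const right_diff_distrib)
  moreover have "bracket \<A> X Y p (\<lambda>x. f x + g x) = bracket \<A> X Y p f + bracket \<A> X Y p g"
    "bracket \<A> X Y p (\<lambda>x. f x * g x) = bracket \<A> X Y p f * g p + f p * bracket \<A> X Y p g"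
    if f: "smooth_near \<A> p f" and g: "smooth_near \<A> p g" for f g
    using f g comp(1,2)[OF X YT f g] comp(1,2)[OF Y XT f g]
    by (simp_all add: bracket_def smooth_near_add smooth_near_mult algebra_simps)
  moreover have "bracket \<A> X Y p f = 0" if "\<not> smooth_near \<A> p f" for f
    using that by (simp add: bracket_def)
  ultimately show ?thesis
    unfolding tangent_space_def by blast
qed

lemma bracket_vector_field:
  assumes X: "vector_field \<A> X" and Y: "vector_field \<A> Y"
  shows "vector_field \<A> (bracket \<A> X Y)"
  unfolding vector_field_on_def
proof (intro conjI ballI allI impI)
  fix W f assume W: "open W \<and> W \<subseteq> UNIV \<and> smooth_fun \<A> W f"
  then have "smooth_fun \<A> W (\<lambda>q. X q (\<lambda>x. Y x f) - Y q (\<lambda>x. X x f))"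
    by (intro smooth_fun_diff vector_field_smooth[OF X] vector_field_smooth[OF Y]) auto
  then show "smooth_fun \<A> W (\<lambda>q. bracket \<A> X Y q f)"
    by (rule smooth_fun_cong[rotated 2])
      (use W in \<open>auto simp: bracket_def intro: smooth_near_of_smooth_fun\<close>)
qed (rule bracket_tangent[OF X Y open_UNIV UNIV_I])

section \<open>Combinations of fields with function coefficients\<close>

definition lin_field :: "('k \<Rightarrow> 'a vfield) \<Rightarrow> ('k::finite \<Rightarrow> 'a \<Rightarrow> complex) \<Rightarrow> 'a vfield" where
  "lin_field E u = (\<lambda>p f. \<Sum>k\<in>UNIV. u k p * E k p f)"

lemma lin_field_vector_field:
  assumes E: "\<And>k. vector_field \<A> (E k)" and u: "\<And>k. smooth_fun \<A> UNIV (u k)"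
  shows "vector_field \<A> (lin_field E u)"
  unfolding vector_field_on_def lin_field_def
proof (intro conjI ballI allI impI)
  fix p show "(\<lambda>f. \<Sum>k\<in>UNIV. u k p * E k p f) \<in> tangent_space \<A> p"
    by (rule tangent_lincomb) (rule vector_field_tangent[OF E UNIV_I])
next
  fix W f assume W: "open W \<and> W \<subseteq> UNIV \<and> smooth_fun \<A> W f"
  show "smooth_fun \<A> W (\<lambda>q. \<Sum>k\<in>UNIV. u k q * E k q f)"
    using W by (intro smooth_fun_sum smooth_fun_mult smooth_fun_subset[OF u] vector_field_smooth[OF E]) auto
qed

text \<open>The product rule yields terms in which a coefficient is differentiated and second-order
  terms in \<open>f\<close>. After exchanging the summation indices in one composite, the
  second-order terms pair up into brackets of the \<open>E k\<close>.\<close>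

lemma bracket_lin_field:
  assumes E: "\<And>k. vector_field \<A> (E k)"
    and u: "\<And>k. smooth_fun \<A> UNIV (u k)" and v: "\<And>k. smooth_fun \<A> UNIV (v k)"
  shows "bracket \<A> (lin_field E u) (lin_field E v) p f =
    (\<Sum>k\<in>UNIV. (lin_field E u p (v k) - lin_field E v p (u k)) * E k p f) +
    (\<Sum>k\<in>UNIV. \<Sum>l\<in>UNIV. u k p * v l p * bracket \<A> (E k) (E l) p f)"
proof (cases "smooth_near \<A> p f")
  case True
  have leibniz: "lin_field E a p (\<lambda>q. lin_field E b q f) =
      (\<Sum>k\<in>UNIV. lin_field E a p (b k) * E k p f) +
      (\<Sum>k\<in>UNIV. \<Sum>l\<in>UNIV. a k p * b l p * E k p (\<lambda>q. E l q f))"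
    if a: "\<And>k. smooth_fun \<A> UNIV (a k)" and b: "\<And>k. smooth_fun \<A> UNIV (b k)" for a b
  proof -
    note T = vector_field_tangent[OF lin_field_vector_field[OF E a] UNIV_I]
    note bs = smooth_near_of_smooth_fun[OF open_UNIV UNIV_I b]
    note Es = vector_field_smooth_near[OF E open_UNIV UNIV_I True]
    have "lin_field E a p (\<lambda>q. lin_field E b q f) =
        (\<Sum>l\<in>UNIV. lin_field E a p (b l) * E l p f + b l p * lin_field E a p (\<lambda>q. E l q f))"
      unfolding lin_field_def[of E b]
      by (simp add: tangent_sum[OF T smooth_near_mult[OF bs Es]] tangent_mult[OF T bs Es])
    moreover have "(\<Sum>l\<in>UNIV. b l p * lin_field E a p (\<lambda>q. E l q f)) =
        (\<Sum>k\<in>UNIV. \<Sum>l\<in>UNIV. a k p * b l p * E k p (\<lambda>q. E l q f))"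
      unfolding lin_field_def by (subst sum.swap) (simp add: sum_distrib_left ac_simps)
    ultimately show ?thesis by (simp add: sum.distrib)
  qed
  have swap: "(\<Sum>k\<in>UNIV. \<Sum>l\<in>UNIV. v k p * u l p * E k p (\<lambda>q. E l q f)) =
      (\<Sum>k\<in>UNIV. \<Sum>l\<in>UNIV. u k p * v l p * E l p (\<lambda>q. E k q f))"
    by (subst sum.swap) (simp add: ac_simps)
  have "(\<Sum>k\<in>UNIV. \<Sum>l\<in>UNIV. u k p * v l p * bracket \<A> (E k) (E l) p f) =
      (\<Sum>k\<in>UNIV. \<Sum>l\<in>UNIV. u k p * v l p * E k p (\<lambda>q. E l q f)) -
      (\<Sum>k\<in>UNIV. \<Sum>l\<in>UNIV. u k p * v l p * E l p (\<lambda>q. E k q f))"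
    using True by (simp add: bracket_def right_diff_distrib sum_subtractf)
  moreover have "bracket \<A> (lin_field E u) (lin_field E v) p f =
      lin_field E u p (\<lambda>q. lin_field E v q f) - lin_field E v p (\<lambda>q. lin_field E u q f)"
    using True by (simp add: bracket_def)
  ultimately show ?thesis
    by (simp add: leibniz[OF u v] leibniz[OF v u] swap left_diff_distrib sum_subtractf)
next
  case False
  then show ?thesis
    by (simp add: bracket_def tangent_not_smooth[OF vector_field_tangent[OF E UNIV_I]])
qed

section \<open>One-forms\<close>

lemma one_form_linear:
  assumes "one_form \<A> \<alpha>" "D \<in> tangent_space \<A> p" "E \<in> tangent_space \<A> p"
  shows "\<alpha> p (\<lambda>f. D f + E f) = \<alpha> p D + \<alpha> p E" "\<alpha> p (\<lambda>f. c * D f) = c * \<alpha> p D"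
  using assms(1)[unfolded one_form_def, THEN conjunct1, rule_format, OF assms(2,3)] by simp_all

lemma one_form_lincomb:
  assumes \<alpha>: "one_form \<A> \<alpha>" and "finite K" and E: "\<And>k. k \<in> K \<Longrightarrow> E k \<in> tangent_space \<A> p"
  shows "\<alpha> p (\<lambda>f. \<Sum>k\<in>K. c k * E k f) = (\<Sum>k\<in>K. c k * \<alpha> p (E k))"
  using assms(2) E
proof (induction K rule: finite_induct)
  case empty
  have "(\<lambda>f. 0) \<in> tangent_space \<A> p"
    using tangent_lincomb[of "{}" undefined p] by simp
  then show ?case
    using one_form_linear(2)[OF \<alpha>, of "\<lambda>f. 0" p "\<lambda>f. 0" 0] by simp
next
  case (insert k K)
  have 1: "(\<lambda>f. c k * E k f) \<in> tangent_space \<A> p"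
    using tangent_lincomb[of "{k}" E p c] insert.prems by simp
  have 2: "(\<lambda>f. \<Sum>k\<in>K. c k * E k f) \<in> tangent_space \<A> p"
    by (rule tangent_lincomb) (use insert.prems in auto)
  have "\<alpha> p (\<lambda>f. c k * E k f + (\<Sum>k\<in>K. c k * E k f)) =
      \<alpha> p (\<lambda>f. c k * E k f) + \<alpha> p (\<lambda>f. \<Sum>k\<in>K. c k * E k f)"
    by (rule one_form_linear(1)[OF \<alpha> 1 2])
  moreover have "\<alpha> p (\<lambda>f. c k * E k f) = c k * \<alpha> p (E k)"
    by (rule one_form_linear(2)[OF \<alpha>]) (use insert.prems in auto)
  moreover have "\<alpha> p (\<lambda>f. \<Sum>k\<in>K. c k * E k f) = (\<Sum>k\<in>K. c k * \<alpha> p (E k))"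
    by (rule insert.IH) (use insert.prems in auto)
  ultimately show ?case by (simp only: sum.insert[OF insert.hyps])
qed

lemma one_form_smooth:
  assumes "one_form \<A> \<alpha>" "open U" "vector_field_on \<A> U X"
  shows "smooth_fun \<A> U (\<lambda>q. \<alpha> q (X q))"
  using assms(1)[unfolded one_form_def, THEN conjunct2, THEN conjunct2] assms(2,3) by blast

lemma vector_field_on_subset: "vector_field_on \<A> U X \<Longrightarrow> V \<subseteq> U \<Longrightarrow> vector_field_on \<A> V X"
  unfolding vector_field_on_def by (meson dual_order.trans subsetD)

text \<open>When \<open>\<alpha>(X)\<close> is constant, the left-hand side is \<open>- d\<alpha>(Y, X)\<close>; the right-hand side shows that
  its value at \<open>p\<close> depends only on \<open>Y p\<close>, without assuming anything on the coefficients of \<open>Y\<close>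
  in a global frame.\<close>

lemma pairing_coord_expansion:
  assumes \<alpha>: "one_form \<A> \<alpha>" and X: "vector_field \<A> X" and Y: "vector_field \<A> Y"
    and c: "(U, \<phi>) \<in> \<A>" and p: "p \<in> U"
  shows "X p (\<lambda>q. \<alpha> q (Y q)) + \<alpha> p (bracket \<A> Y X p) =
    (\<Sum>b\<in>Basis. Y p (coord \<phi> b) *
      (X p (\<lambda>q. \<alpha> q (coord_field U \<phi> b q)) + \<alpha> p (bracket \<A> (coord_field U \<phi> b) X p)))"
proof -
  let ?d = "coord_field U \<phi>" and ?y = "\<lambda>b q. Y q (coord \<phi> b)"
  note U = chart_open[OF c]
  note dv = coord_field_vector_field[OF c] and dT = coord_field_tangent[OF c p]
  note XU = vector_field_on_subset[OF X subset_UNIV, of U]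
  note XT = vector_field_tangent[OF X UNIV_I, of p] and YT = vector_field_tangent[OF Y UNIV_I]
  have ys: "smooth_near \<A> p (?y b)" for b
    by (rule vector_field_smooth_near[OF Y open_UNIV UNIV_I smooth_near_coord[OF c p]])
  have as: "smooth_near \<A> p (\<lambda>q. \<alpha> q (?d b q))" for b
    by (rule smooth_near_of_smooth_fun[OF U p one_form_smooth[OF \<alpha> U dv]])
  have Yexp: "Y q = (\<lambda>f. \<Sum>b\<in>Basis. ?y b q * ?d b q f)" if "q \<in> U" for q
    by (rule tangent_coord_field_expansion[OF c that YT])
  have ev: "\<forall>\<^sub>F q in nhds p. q \<in> U" using U p eventually_nhds by blast
  have "\<forall>\<^sub>F q in nhds p. \<alpha> q (Y q) = (\<Sum>b\<in>Basis. ?y b q * \<alpha> q (?d b q))"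
    using ev
  proof eventually_elim
    case (elim q)
    show ?case
      by (subst Yexp[OF elim]) (rule one_form_lincomb[OF \<alpha> finite_Basis coord_field_tangent[OF c elim]])
  qed
  from tangent_cong[OF XT this]
  have 1: "X p (\<lambda>q. \<alpha> q (Y q)) =
      (\<Sum>b\<in>Basis. X p (?y b) * \<alpha> p (?d b p) + ?y b p * X p (\<lambda>q. \<alpha> q (?d b q)))"
    by (simp add: tangent_sum[OF XT smooth_near_mult[OF ys as]] tangent_mult[OF XT ys as])
  have "bracket \<A> Y X p f = (\<Sum>b\<in>Basis. ?y b p * bracket \<A> (?d b) X p f) +
      (\<Sum>b\<in>Basis. - X p (?y b) * ?d b p f)" for f
  proof (cases "smooth_near \<A> p f")
    case True
    note ds = vector_field_smooth_near[OF dv U p True]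
    have "\<forall>\<^sub>F q in nhds p. Y q f = (\<Sum>b\<in>Basis. ?y b q * ?d b q f)"
      using ev by eventually_elim (use Yexp in metis)
    from tangent_cong[OF XT this]
    have "X p (\<lambda>q. Y q f) = (\<Sum>b\<in>Basis. X p (?y b) * ?d b p f + ?y b p * X p (\<lambda>q. ?d b q f))"
      by (simp add: tangent_sum[OF XT smooth_near_mult[OF ys ds]] tangent_mult[OF XT ys ds])
    moreover have "Y p (\<lambda>q. X q f) = (\<Sum>b\<in>Basis. ?y b p * ?d b p (\<lambda>q. X q f))"
      using Yexp[OF p] by metis
    ultimately show ?thesis
      using True by (simp add: bracket_def algebra_simps sum.distrib sum_subtractf sum_negf)
  next
    case False
    then show ?thesis by (simp add: bracket_def coord_field_def)
  qed
  then have "bracket \<A> Y X p = (\<lambda>f. (\<Sum>b\<in>Basis. ?y b p * bracket \<A> (?d b) X p f) +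
      (\<Sum>b\<in>Basis. - X p (?y b) * ?d b p f))"
    by (rule ext)
  then have "\<alpha> p (bracket \<A> Y X p) =
      \<alpha> p (\<lambda>f. \<Sum>b\<in>Basis. ?y b p * bracket \<A> (?d b) X p f) +
      \<alpha> p (\<lambda>f. \<Sum>b\<in>Basis. - X p (?y b) * ?d b p f)"
    by (simp only: one_form_linear(1)[OF \<alpha> tangent_lincomb[OF bracket_tangent[OF dv XU U p]]
          tangent_lincomb[OF dT]])
  also have "\<dots> = (\<Sum>b\<in>Basis. ?y b p * \<alpha> p (bracket \<A> (?d b) X p)) +
      (\<Sum>b\<in>Basis. - X p (?y b) * \<alpha> p (?d b p))"
    by (simp only: one_form_lincomb[OF \<alpha> finite_Basis bracket_tangent[OF dv XU U p]]
        one_form_lincomb[OF \<alpha> finite_Basis dT])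
  \<comment> \<open>The terms containing \<open>X p (?y b)\<close> occur in both expansions with
    opposite signs. Their cancellation is the tensoriality: only the values \<open>?y b p\<close>
    survive.\<close>
  finally show ?thesis
    using 1 by (simp add: algebra_simps sum.distrib sum_subtractf sum_negf)
qed

end

section \<open>The Heisenberg frame\<close>

lemma sum_option_sum:
  fixes g :: "('n::finite + 'n) option \<Rightarrow> 'b::comm_monoid_add"
  shows "(\<Sum>k\<in>UNIV. g k) = g None + ((\<Sum>i\<in>UNIV. g (Some (Inl i))) + (\<Sum>i\<in>UNIV. g (Some (Inr i))))"
proof -
  have "(\<Sum>k\<in>UNIV. g k) = g None + (\<Sum>k\<in>UNIV. g (Some k))"
    unfolding UNIV_option_conv by (subst sum.insert) (simp_all add: sum.reindex)
  also have "(\<Sum>k\<in>UNIV. g (Some k)) = (\<Sum>i\<in>UNIV. g (Some (Inl i))) + (\<Sum>i\<in>UNIV. g (Some (Inr i)))"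
    unfolding UNIV_Plus_UNIV[symmetric] by (subst sum.Plus) simp_all
  finally show ?thesis .
qed

lemma bracket_swap: "bracket \<A> X Y p f = - bracket \<A> Y X p f"
  by (simp add: bracket_def)

lemma frame_index_cases:
  fixes k :: "('n + 'm) option"
  obtains "k = None" | i where "k = Some (Inl i)" | j where "k = Some (Inr j)"
  by (metis option.exhaust sum.exhaust)

locale heisenberg = smooth_manifold \<A>
  for \<A> :: "('a::{t2_space,second_countable_topology}, 'e::euclidean_space) atlas" +
  fixes \<alpha> :: "'a \<Rightarrow> 'a tvec \<Rightarrow> complex"
    and A B :: "'n::finite \<Rightarrow> 'a vfield" and Z :: "'a vfield"
  assumes dim: "DIM('e) = 2 * CARD('n) + 1"
    and heisenberg: "heisenberg_structure \<A> \<alpha> A B Z"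
begin

text \<open>The index type is that of the columns with one extra point for \<open>Z\<close>. Its
  cardinality is the dimension in \<open>dim\<close>, and the column entries are the coefficients at
  \<open>Some\<close>.\<close>

definition frame :: "('n + 'n) option \<Rightarrow> 'a vfield" where
  "frame k = (case k of None \<Rightarrow> Z | Some (Inl i) \<Rightarrow> A i | Some (Inr i) \<Rightarrow> B i)"

lemma frame_simps [simp]:
  "frame None = Z" "frame (Some (Inl i)) = A i" "frame (Some (Inr i)) = B i"
  by (simp_all add: frame_def)

lemma one_form: "one_form \<A> \<alpha>"
  using heisenberg by (simp add: heisenberg_structure_def contact_form_def)

lemma frame_real: "real_vector_field \<A> (frame k)"
  using heisenberg
  by (auto simp: heisenberg_structure_def reeb_field_def frame_def split: option.split sum.split)

lemma frame_vector_field: "vector_field \<A> (frame k)"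
  using frame_real unfolding real_vector_field_def by blast

lemma frame_tangent: "frame k p \<in> tangent_space \<A> p"
  by (rule vector_field_tangent[OF frame_vector_field UNIV_I])

lemma contact_form_frame: "\<alpha> p (frame k p) = (if k = None then 1 else 0)"
  using heisenberg
  by (auto simp: heisenberg_structure_def reeb_field_def frame_def split: option.split sum.split)

text \<open>Structure constants of the Heisenberg algebra; no upper index is needed, as every
  bracket of frame fields is a multiple of \<open>Z\<close>.\<close>

fun frame_bracket :: "('n + 'n) option \<Rightarrow> ('n + 'n) option \<Rightarrow> complex" where
  "frame_bracket (Some (Inl i)) (Some (Inr j)) = (if i = j then 1 else 0)"
| "frame_bracket (Some (Inr i)) (Some (Inl j)) = (if i = j then - 1 else 0)"
| "frame_bracket _ _ = 0"

lemma bracket_frame: "bracket \<A> (frame k) (frame l) p f = frame_bracket k l * Z p f"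
proof -
  have "bracket \<A> (A i) (B j) = (if i = j then Z else zero_field)"
    "bracket \<A> (A i) (A j) = zero_field" "bracket \<A> (B i) (B j) = zero_field"
    "bracket \<A> (A i) Z = zero_field" "bracket \<A> (B i) Z = zero_field" for i j
    using heisenberg by (simp_all add: heisenberg_structure_def)
  moreover have "bracket \<A> Z Z p f = 0" by (simp add: bracket_def)
  ultimately show ?thesis
    by (cases k rule: frame_index_cases; cases l rule: frame_index_cases)
      (auto simp: zero_field_def bracket_swap[of \<A> "B _" "A _"] bracket_swap[of \<A> Z "A _"] bracket_swap[of \<A> Z "B _"])
qed

lemma contact_form_lincomb: "\<alpha> p (\<lambda>f. \<Sum>k\<in>UNIV. c k * frame k p f) = c None"
proof -
  have "\<alpha> p (\<lambda>f. \<Sum>k\<in>UNIV. c k * frame k p f) = (\<Sum>k\<in>UNIV. c k * \<alpha> p (frame k p))"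
    by (rule one_form_lincomb[OF one_form finite]) (rule frame_tangent)
  then show ?thesis by (simp add: contact_form_frame sum_option_sum)
qed

section \<open>The frame as a basis of each tangent space\<close>

text \<open>The Heisenberg structure grants independence only among the \<open>A i\<close> and
  \<open>B i\<close>. Since \<open>\<alpha>\<close> reads off the coefficient of \<open>Z\<close>,
  applying it removes \<open>Z\<close> first.\<close>

lemma frame_real_independent:
  fixes c :: "('n + 'n) option \<Rightarrow> real"
  assumes "\<And>f. (\<Sum>k\<in>UNIV. complex_of_real (c k) * frame k p f) = 0"
  shows "c k = 0"
proof -
  have "(\<lambda>f. \<Sum>k\<in>UNIV. complex_of_real (c k) * frame k p f) = (\<lambda>f. \<Sum>k\<in>UNIV. 0 * frame k p f)"
    using assms by simp
  then have "complex_of_real (c None) = 0"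
    using contact_form_lincomb[of p "\<lambda>k. complex_of_real (c k)"] contact_form_lincomb[of p "\<lambda>k. 0"] by simp
  then have 0: "c None = 0" by simp
  have "\<forall>f. (\<Sum>i\<in>UNIV. of_real (c (Some (Inl i))) * A i p f + of_real (c (Some (Inr i))) * B i p f) = 0"
    using assms 0 by (simp add: sum_option_sum sum.distrib)
  moreover have "\<forall>p. \<forall>a b :: 'n \<Rightarrow> real.
      (\<forall>f. (\<Sum>i\<in>UNIV. of_real (a i) * A i p f + of_real (b i) * B i p f) = 0) \<longrightarrow>
      (\<forall>i. a i = 0 \<and> b i = 0)"
    using heisenberg unfolding heisenberg_structure_def by (elim conjE)
  ultimately have "\<forall>i. c (Some (Inl i)) = 0 \<and> c (Some (Inr i)) = 0"
    by (elim allE[of _ p] allE[of _ "\<lambda>i. c (Some (Inl i))"] allE[of _ "\<lambda>i. c (Some (Inr i))"] impE)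
  with 0 show ?thesis by (cases k rule: frame_index_cases) auto
qed

text \<open>In a chart, the real frame vectors become vectors of \<open>'e\<close>; since there are as many of them as
  the dimension of \<open>'e\<close>, linear independence makes the linear map with these columns bijective.\<close>

lemma frame_coord_bij:
  assumes c: "(U, \<phi>) \<in> \<A>" and p: "p \<in> U"
  obtains L :: "real ^ (('n + 'n) option) \<Rightarrow> 'e" where "linear L" "inj L" "surj L"
    "\<And>x b. b \<in> Basis \<Longrightarrow> complex_of_real (L x \<bullet> b) = (\<Sum>k\<in>UNIV. complex_of_real (x $ k) * frame k p (coord \<phi> b))"
proof
  define L where "L x = (\<Sum>b\<in>Basis. (\<Sum>k\<in>UNIV. x $ k * Re (frame k p (coord \<phi> b))) *\<^sub>R b)"
    for x :: "real ^ (('n + 'n) option)"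
  \<comment> \<open>Real fields act on real-valued coordinate functions, so taking real parts in
    \<open>L\<close> loses nothing.\<close>
  have "frame k p (coord \<phi> b) \<in> \<real>" for k b
    using frame_real unfolding real_vector_field_def real_tvec_def by (simp add: coord_def)
  then have re: "complex_of_real (Re (frame k p (coord \<phi> b))) = frame k p (coord \<phi> b)" for k b
    by simp
  have Lb: "L x \<bullet> b = (\<Sum>k\<in>UNIV. x $ k * Re (frame k p (coord \<phi> b)))" if "b \<in> Basis" for x b
    unfolding L_def using that by (simp add: inner_sum_left inner_Basis if_distrib cong: if_cong)
  show *: "complex_of_real (L x \<bullet> b) = (\<Sum>k\<in>UNIV. complex_of_real (x $ k) * frame k p (coord \<phi> b))"
    if "b \<in> Basis" for x b
    unfolding Lb[OF that] by (simp add: re)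
  show lin: "linear L"
    unfolding L_def
    by (rule linearI) (simp_all add: algebra_simps sum.distrib scaleR_sum_right sum_distrib_left)
  show inj: "inj L"
    unfolding linear_injective_0[OF lin]
  proof (intro allI impI)
    fix x assume x: "L x = 0"
    \<comment> \<open>A tangent vector that kills all coordinate functions is zero by the coordinate
      expansion; this turns \<open>L x = 0\<close> into a real linear relation between the frame
      vectors.\<close>
    let ?D = "\<lambda>f. \<Sum>k\<in>UNIV. complex_of_real (x $ k) * frame k p f"
    have "?D (coord \<phi> b) = 0" if "b \<in> Basis" for b
      using *[OF that, of x] x by simp
    moreover have "?D \<in> tangent_space \<A> p"
      by (rule tangent_lincomb) (rule frame_tangent)
    ultimately have "?D f = 0" for f
      using fun_cong[OF tangent_coord_field_expansion[OF c p, of ?D], of f] by simp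
    from frame_real_independent[OF this] show "x = 0" by (simp add: vec_eq_iff)
  qed
  have "dim (range L) = DIM(real ^ (('n + 'n) option))"
    using dim_image_eq[OF lin, of UNIV] inj by simp
  also have "\<dots> = DIM('e)" by (simp add: dim)
  finally have "span (range L) = UNIV" by (simp only: dim_eq_full)
  then show "surj L"
    using linear_subspace_image[OF lin subspace_UNIV] span_eq_iff by metis
qed

text \<open>Because \<open>L\<close> is real, a vanishing complex combination separates into two
  real systems, one for the real and one for the imaginary parts of the coefficients.\<close>

lemma frame_independent:
  assumes "\<And>f. (\<Sum>k\<in>UNIV. c k * frame k p f) = (\<Sum>k\<in>UNIV. d k * frame k p f)"
  shows "c = d"
proof -
  obtain U \<phi> where U: "(U, \<phi>) \<in> \<A>" "p \<in> U" by (rule chart_at)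
  obtain L :: "real ^ (('n + 'n) option) \<Rightarrow> 'e" where L: "linear L" "inj L" "surj L" and Lb: "\<And>x b. b \<in> Basis \<Longrightarrow> complex_of_real (L x \<bullet> b) =
      (\<Sum>k\<in>UNIV. complex_of_real (x $ k) * frame k p (coord \<phi> b))"
    by (rule frame_coord_bij[OF U]) blast
  have zero: "x = 0" if "\<And>b. b \<in> Basis \<Longrightarrow> complex_of_real (L x \<bullet> b) = 0" for x
  proof -
    have "L x = 0" using that by (simp add: euclidean_eq_iff[of "L x"])
    then show ?thesis using L(2) unfolding linear_injective_0[OF L(1)] by blast
  qed
  define e where "e k = c k - d k" for k
  let ?x = "\<chi> k. Re (e k)" and ?y = "\<chi> k. Im (e k)"
  have "complex_of_real (L ?x \<bullet> b) + \<i> * complex_of_real (L ?y \<bullet> b) = 0" if b: "b \<in> Basis" for b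
  proof -
    have "complex_of_real (L ?x \<bullet> b) + \<i> * complex_of_real (L ?y \<bullet> b) =
        (\<Sum>k\<in>UNIV. (complex_of_real (Re (e k)) + \<i> * complex_of_real (Im (e k))) * frame k p (coord \<phi> b))"
      by (simp add: Lb[OF b] sum_distrib_left sum.distrib algebra_simps)
    also have "\<dots> = (\<Sum>k\<in>UNIV. e k * frame k p (coord \<phi> b))"
      by (simp only: complex_eq[symmetric])
    also have "\<dots> = 0"
      using assms by (simp add: e_def left_diff_distrib sum_subtractf)
    finally show ?thesis .
  qed
  then have "L ?x \<bullet> b = 0 \<and> L ?y \<bullet> b = 0" if "b \<in> Basis" for b
    using that by (simp add: complex_eq_iff)
  then have "?x = 0" "?y = 0" using zero by simp_all
  then have "e k = 0" for k by (simp add: vec_eq_iff complex_eq_iff)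
  then show ?thesis by (simp add: e_def fun_eq_iff)
qed

lemma frame_spans:
  assumes D: "D \<in> tangent_space \<A> p"
  obtains c where "D = (\<lambda>f. \<Sum>k\<in>UNIV. c k * frame k p f)"
proof -
  obtain U \<phi> where U: "(U, \<phi>) \<in> \<A>" "p \<in> U" by (rule chart_at)
  obtain L :: "real ^ (('n + 'n) option) \<Rightarrow> 'e" where L: "linear L" "inj L" "surj L" and Lb: "\<And>x b. b \<in> Basis \<Longrightarrow> complex_of_real (L x \<bullet> b) =
      (\<Sum>k\<in>UNIV. complex_of_real (x $ k) * frame k p (coord \<phi> b))"
    by (rule frame_coord_bij[OF U]) blast
  \<comment> \<open>The components of \<open>D\<close> are complex; \<open>L\<close> is solved for
    their real and imaginary parts separately, and the two solutions are assembled into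
    \<open>c\<close>.\<close>
  obtain x where x: "L x = (\<Sum>b\<in>Basis. Re (D (coord \<phi> b)) *\<^sub>R b)" using surjD[OF L(3)] by metis
  obtain y where y: "L y = (\<Sum>b\<in>Basis. Im (D (coord \<phi> b)) *\<^sub>R b)" using surjD[OF L(3)] by metis
  define c where "c k = Complex (x $ k) (y $ k)" for k
  let ?E = "\<lambda>f. \<Sum>k\<in>UNIV. c k * frame k p f"
  have ED: "?E (coord \<phi> b) = D (coord \<phi> b)" if b: "b \<in> Basis" for b
  proof -
    have "?E (coord \<phi> b) = complex_of_real (L x \<bullet> b) + \<i> * complex_of_real (L y \<bullet> b)"
      by (simp add: c_def Complex_eq Lb[OF b] sum_distrib_left sum.distrib algebra_simps)
    also have "\<dots> = D (coord \<phi> b)"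
      using b by (simp add: x y inner_sum_left inner_Basis if_distrib complex_eq_iff cong: if_cong)
    finally show ?thesis .
  qed
  have E: "?E \<in> tangent_space \<A> p"
    by (rule tangent_lincomb) (rule frame_tangent)
  have "D f = ?E f" for f
    using fun_cong[OF tangent_coord_field_expansion[OF U D], of f]
      fun_cong[OF tangent_coord_field_expansion[OF U E], of f] ED by simp
  then show ?thesis using that by blast
qed

section \<open>Smooth frame coefficients\<close>

lemma frame_decomposition:
  assumes Y: "vector_field \<A> Y"
  obtains v where "\<And>k. smooth_fun \<A> UNIV (v k)" "Y = lin_field frame v"
proof -
  define pairing where "pairing W k p = frame k p (\<lambda>q. \<alpha> q (W q)) + \<alpha> p (bracket \<A> W (frame k) p)"
    for W k p
  have "\<exists>c. Y p = (\<lambda>f. \<Sum>k\<in>UNIV. c k * frame k p f)" for p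
    using frame_spans[OF vector_field_tangent[OF Y UNIV_I]] by metis
  then obtain c where c: "\<And>p. Y p = (\<lambda>f. \<Sum>k\<in>UNIV. c p k * frame k p f)" by metis
  have "smooth_fun \<A> UNIV (pairing Y k)" for k
    unfolding pairing_def
    by (intro smooth_fun_add open_UNIV one_form_smooth[OF one_form]
        vector_field_smooth[OF frame_vector_field] bracket_vector_field Y frame_vector_field) simp
  moreover have "smooth_fun \<A> UNIV (\<lambda>p. \<alpha> p (Y p))"
    by (rule one_form_smooth[OF one_form open_UNIV Y])
  moreover have None: "c p None = \<alpha> p (Y p)" for p
    by (simp add: c contact_form_lincomb)
  moreover have pair: "pairing Y k p = (\<Sum>l\<in>UNIV. c p l * frame_bracket l k)" for k p
  proof -
    obtain U \<phi> where U: "(U, \<phi>) \<in> \<A>" "p \<in> U" by (rule chart_at)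
    \<comment> \<open>The weights \<open>\<kappa> b\<close> do not depend on the field that is
      paired, so the merely pointwise expansion of \<open>Y p\<close> in the frame passes through
      the pairing.\<close>
    define \<kappa> where "\<kappa> b = frame k p (\<lambda>q. \<alpha> q (coord_field U \<phi> b q)) +
      \<alpha> p (bracket \<A> (coord_field U \<phi> b) (frame k) p)" for b
    have \<kappa>: "pairing W k p = (\<Sum>b\<in>Basis. W p (coord \<phi> b) * \<kappa> b)" if "vector_field \<A> W" for W
      unfolding pairing_def \<kappa>_def by (rule pairing_coord_expansion[OF one_form frame_vector_field that U])
    have frame_pair: "pairing (frame l) k p = frame_bracket l k" for l
    proof -
      have "\<alpha> p (\<lambda>f. frame_bracket l k * Z p f) = frame_bracket l k"
        using one_form_linear(2)[OF one_form frame_tangent[of None p] frame_tangent[of None p], of "frame_bracket l k"]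
          contact_form_frame[of p None] by simp
      moreover have "bracket \<A> (frame l) (frame k) p = (\<lambda>f. frame_bracket l k * Z p f)"
        by (rule ext) (rule bracket_frame)
      ultimately show ?thesis
        by (simp add: pairing_def contact_form_frame tangent_const[OF frame_tangent])
    qed
    have "pairing Y k p = (\<Sum>l\<in>UNIV. c p l * pairing (frame l) k p)"
      unfolding \<kappa>[OF Y] \<kappa>[OF frame_vector_field] c
      by (simp add: sum_distrib_left sum_distrib_right mult.assoc) (rule sum.swap)
    then show ?thesis by (simp add: frame_pair)
  qed
  \<comment> \<open>Since \<open>[A_i, B_i] = Z\<close>, pairing with \<open>B i\<close> isolates
    the coefficient of \<open>A i\<close>, and pairing with \<open>A i\<close> isolates minus the
    coefficient of \<open>B i\<close>.\<close>
  have Inl: "c p (Some (Inl i)) = pairing Y (Some (Inr i)) p"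
    and Inr: "c p (Some (Inr i)) = - pairing Y (Some (Inl i)) p" for i p
    by (simp_all add: pair sum_option_sum if_distrib cong: if_cong)
  ultimately have "smooth_fun \<A> UNIV (\<lambda>p. c p k)" for k
    by (cases k rule: frame_index_cases) (auto simp: None Inl Inr intro!: smooth_fun_minus)
  moreover have "Y = lin_field frame (\<lambda>k p. c p k)"
    unfolding lin_field_def using c by blast
  ultimately show ?thesis by (rule that)
qed


section \<open>Contact Hamiltonians\<close>

lemma lin_field_frame_inject:
  assumes "lin_field frame u = lin_field frame v"
  shows "u = v"
proof -
  have "(\<lambda>k. u k p) = (\<lambda>k. v k p)" for p
    by (rule frame_independent) (use fun_cong[OF fun_cong[OF assms]] in \<open>simp add: lin_field_def\<close>)
  then show ?thesis by (meson ext)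
qed

lemma contact_form_lin_field: "\<alpha> p (lin_field frame u p) = u None p"
  unfolding lin_field_def by (rule contact_form_lincomb)

lemma lin_field_frame_tangent:
  "(\<And>k. smooth_fun \<A> UNIV (u k)) \<Longrightarrow> lin_field frame u p \<in> tangent_space \<A> p"
  by (rule vector_field_tangent[OF lin_field_vector_field[OF frame_vector_field] UNIV_I])

text \<open>This is \<open>- d\<alpha>\<close> in frame coefficients, because
  \<open>d\<alpha>(A_i, B_i) = - \<alpha>([A_i, B_i]) = -1\<close>. The \<open>None\<close> entries
  are absent because \<open>Z\<close> lies in the kernel of \<open>d\<alpha>\<close>.\<close>

definition frame_form :: "(('n + 'n) option \<Rightarrow> complex) \<Rightarrow> (('n + 'n) option \<Rightarrow> complex) \<Rightarrow> complex" where
  "frame_form x y = (\<Sum>i\<in>UNIV. x (Some (Inl i)) * y (Some (Inr i)) - x (Some (Inr i)) * y (Some (Inl i)))"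

lemma frame_form_eq: "frame_form x y = (\<Sum>k\<in>UNIV. \<Sum>l\<in>UNIV. x k * y l * frame_bracket k l)"
  by (simp add: frame_form_def sum_option_sum if_distrib sum_subtractf sum_negf cong: if_cong)

lemma bracket_lin_field_frame:
  assumes u: "\<And>k. smooth_fun \<A> UNIV (u k)" and v: "\<And>k. smooth_fun \<A> UNIV (v k)"
  shows "bracket \<A> (lin_field frame u) (lin_field frame v) = lin_field frame
    (\<lambda>k p. lin_field frame u p (v k) - lin_field frame v p (u k) +
      (if k = None then frame_form (\<lambda>l. u l p) (\<lambda>l. v l p) else 0))"
proof -
  define w where "w = (\<lambda>k p. lin_field frame u p (v k) - lin_field frame v p (u k) +
    (if k = None then frame_form (\<lambda>l. u l p) (\<lambda>l. v l p) else 0))"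
  have "bracket \<A> (lin_field frame u) (lin_field frame v) p f = lin_field frame w p f" for p f
  proof -
    have "(\<Sum>k\<in>UNIV. \<Sum>l\<in>UNIV. u k p * v l p * bracket \<A> (frame k) (frame l) p f) =
        frame_form (\<lambda>l. u l p) (\<lambda>l. v l p) * frame None p f"
      by (simp add: bracket_frame frame_form_eq sum_distrib_right mult.assoc)
    moreover have "(\<Sum>k\<in>UNIV. (if k = None then x else 0) * frame k p f) = x * frame None p f" for x
      by (simp add: sum_option_sum)
    ultimately show ?thesis
      unfolding bracket_lin_field[OF frame_vector_field u v] lin_field_def[of frame w]
      by (simp only: w_def distrib_right sum.distrib)
  qed
  then show ?thesis unfolding w_def by (intro ext)
qed

text \<open>The derivative of \<open>v None\<close> along the first field cancels against the same
  term in the bracket, so no derivative of \<open>v\<close> remains and the result is pointwise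
  linear in \<open>v\<close>.\<close>

lemma lie_deriv_lin_field:
  assumes u: "\<And>k. smooth_fun \<A> UNIV (u k)" and v: "\<And>k. smooth_fun \<A> UNIV (v k)"
  shows "lie_deriv \<A> (lin_field frame u) \<alpha> (lin_field frame v) p =
    lin_field frame v p (u None) - frame_form (\<lambda>l. u l p) (\<lambda>l. v l p)"
  by (simp add: lie_deriv_def bracket_lin_field_frame[OF u v] contact_form_lin_field)

section \<open>The contact field of a Hamiltonian\<close>

text \<open>These coefficients \<open>u\<close> solve \<open>E(H) = \<omega>(u, E)\<close> for the
  tangent frame fields: \<open>E = B_i\<close> gives the coefficient of \<open>A_i\<close>, and
  \<open>E = A_i\<close> gives minus that of \<open>B_i\<close>.\<close>

definition hamiltonian_coeff :: "('a \<Rightarrow> complex) \<Rightarrow> ('n + 'n) option \<Rightarrow> 'a \<Rightarrow> complex" where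
  "hamiltonian_coeff H k = (case k of None \<Rightarrow> H
    | Some (Inl i) \<Rightarrow> (\<lambda>q. B i q H) | Some (Inr i) \<Rightarrow> (\<lambda>q. - A i q H))"

lemma hamiltonian_coeff_simps [simp]:
  "hamiltonian_coeff H None = H"
  "hamiltonian_coeff H (Some (Inl i)) = (\<lambda>q. B i q H)"
  "hamiltonian_coeff H (Some (Inr i)) = (\<lambda>q. - A i q H)"
  by (simp_all add: hamiltonian_coeff_def)

lemma hamiltonian_coeff_smooth:
  assumes "smooth_fun \<A> UNIV H"
  shows "smooth_fun \<A> UNIV (hamiltonian_coeff H k)"
proof -
  have "smooth_fun \<A> UNIV (\<lambda>q. frame l q H)" for l
    by (rule vector_field_smooth[OF frame_vector_field open_UNIV subset_UNIV assms])
  from this[of "Some (Inr _)"] smooth_fun_minus[OF open_UNIV this[of "Some (Inl _)"]] assms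
  show ?thesis by (cases k rule: frame_index_cases) simp_all
qed

text \<open>Existence holds with conformal factor \<open>Z(H)\<close>. For uniqueness, the unknown
  factor of a competitor drops out on tangent fields, where \<open>\<alpha>\<close> vanishes, and
  testing on the \<open>A i\<close> and \<open>B i\<close> already fixes all its
  coefficients.\<close>

lemma contact_field_eq:
  assumes H: "smooth_fun \<A> UNIV H"
  shows "contact_field \<A> \<alpha> H = lin_field frame (hamiltonian_coeff H)"
  unfolding contact_field_def
proof (rule the_equality)
  note h = hamiltonian_coeff_smooth[OF H]
  have "lie_deriv \<A> (lin_field frame (hamiltonian_coeff H)) \<alpha> Y p = Z p H * \<alpha> p (Y p)"
    if Y: "vector_field \<A> Y" for Y p
  proof -
    obtain v where v: "\<And>k. smooth_fun \<A> UNIV (v k)" and Yv: "Y = lin_field frame v"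
      by (rule frame_decomposition[OF Y]) blast
    show ?thesis
      unfolding Yv lie_deriv_lin_field[OF h v] contact_form_lin_field
      by (simp add: lin_field_def frame_form_def sum_option_sum sum.distrib sum_subtractf sum_negf mult.commute)
  qed
  then show "lin_field frame (hamiltonian_coeff H) \<in> CVect \<A> \<alpha> \<and>
      (\<forall>p. \<alpha> p (lin_field frame (hamiltonian_coeff H) p) = H p)"
    unfolding CVect_def
    by (auto simp: contact_form_lin_field lin_field_vector_field[OF frame_vector_field h]
        intro!: exI[of _ "\<lambda>p. Z p H"])
next
  fix X assume X: "X \<in> CVect \<A> \<alpha> \<and> (\<forall>p. \<alpha> p (X p) = H p)"
  then obtain f where XV: "vector_field \<A> X"
    and f: "\<And>Y p. vector_field \<A> Y \<Longrightarrow> lie_deriv \<A> X \<alpha> Y p = f p * \<alpha> p (Y p)"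
    unfolding CVect_def by blast
  obtain u where u: "\<And>k. smooth_fun \<A> UNIV (u k)" and Xu: "X = lin_field frame u"
    by (rule frame_decomposition[OF XV]) blast
  have uH: "u None = H"
    using X by (auto simp: Xu contact_form_lin_field)
  have eq: "frame l p H = frame_form (\<lambda>k. u k p) (\<lambda>k. if k = l then 1 else 0)" if "l \<noteq> None" for l p
  proof -
    \<comment> \<open>The test field is the frame field of index \<open>l\<close>, written with
      constant coefficients so that \<open>lie_deriv_lin_field\<close> applies.\<close>
    define v :: "('n + 'n) option \<Rightarrow> 'a \<Rightarrow> complex" where "v k = (\<lambda>p. if k = l then 1 else 0)" for k
    have v: "smooth_fun \<A> UNIV (v k)" for k
      unfolding v_def by (rule smooth_fun_const)
    have "lin_field frame v p H = frame l p H"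
      by (simp add: lin_field_def v_def if_distrib[of "\<lambda>x. x * _"] cong: if_cong)
    moreover have "lie_deriv \<A> (lin_field frame u) \<alpha> (lin_field frame v) p = 0"
      using f[OF lin_field_vector_field[of frame v, OF frame_vector_field v], of p] that
      by (simp add: Xu contact_form_lin_field v_def)
    moreover have "(\<lambda>k. v k p) = (\<lambda>k. if k = l then 1 else 0)"
      by (simp add: v_def)
    ultimately show ?thesis
      unfolding lie_deriv_lin_field[OF u v] uH by simp
  qed
  have "u k p = hamiltonian_coeff H k p" for k p
  proof (cases k rule: frame_index_cases)
    case (2 i)
    then show ?thesis
      using eq[of "Some (Inr i)" p] by (simp add: frame_form_def if_distrib[of "\<lambda>x. _ * x"] cong: if_cong)
  next
    case (3 i)
    then show ?thesis
      using eq[of "Some (Inl i)" p]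
      by (simp add: frame_form_def if_distrib[of "\<lambda>x. _ * x"] sum_negf cong: if_cong)
  qed (simp add: uH)
  then have "u = hamiltonian_coeff H" by (intro ext)
  then show "X = lin_field frame (hamiltonian_coeff H)" by (simp add: Xu)
qed

section \<open>The action on tangent fields\<close>

lemma field_of_column_eq:
  "field_of_column A B V = lin_field frame (\<lambda>k p. case k of None \<Rightarrow> 0 | Some j \<Rightarrow> V p $ j)"
  by (simp add: field_of_column_def lin_field_def sum_option_sum sum.distrib)

text \<open>Independence of the frame gives the uniqueness that the description operator needs; with
  a nonzero coefficient of \<open>Z\<close> there would be no column to describe.\<close>

lemma coeff_column_lin_field:
  assumes v: "\<And>k. smooth_fun \<A> UNIV (v k)" and "v None = (\<lambda>p. 0)"
  shows "coeff_column \<A> A B (lin_field frame v) = (\<lambda>p. \<chi> k. v (Some k) p)"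
  unfolding coeff_column_def
proof (rule the_equality)
  have "(\<lambda>k p. case k of None \<Rightarrow> 0 | Some j \<Rightarrow> (\<chi> k. v (Some k) p) $ j) = v"
    using assms(2) by (auto simp: fun_eq_iff split: option.split)
  then show "(\<forall>k. smooth_fun \<A> UNIV (\<lambda>p. (\<chi> k. v (Some k) p) $ k)) \<and>
      lin_field frame v = field_of_column A B (\<lambda>p. \<chi> k. v (Some k) p)"
    unfolding field_of_column_eq using v by simp
next
  fix V assume "(\<forall>k. smooth_fun \<A> UNIV (\<lambda>p. V p $ k)) \<and> lin_field frame v = field_of_column A B V"
  then have "v = (\<lambda>k p. case k of None \<Rightarrow> 0 | Some j \<Rightarrow> V p $ j)"
    unfolding field_of_column_eq using lin_field_frame_inject by blast
  then show "V = (\<lambda>p. \<chi> k. v (Some k) p)"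
    by (simp add: fun_eq_iff vec_eq_iff)
qed

text \<open>Row \<open>Inl i\<close> of the matrix contains derivatives of \<open>B_i(H)\<close>,
  the coefficient of \<open>A_i\<close> in the contact field, and row \<open>Inr i\<close> those of
  \<open>- A_i(H)\<close>; the column index tells which frame field differentiates.\<close>

lemma contact_action_on_columns:
  assumes H: "smooth_fun \<A> UNIV H" and X: "X \<in> TVect \<A> \<alpha>"
  shows "bracket \<A> (contact_field \<A> \<alpha> H) X \<in> TVect \<A> \<alpha> \<and>
    coeff_column \<A> A B (bracket \<A> (contact_field \<A> \<alpha> H) X) =
      (\<lambda>p. componentwise (contact_field \<A> \<alpha> H) (coeff_column \<A> A B X) p -
        block_matrix (second_deriv A B H p) (second_deriv B B H p)
          (- second_deriv A A H p) (- second_deriv B A H p) *v coeff_column \<A> A B X p)"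
proof -
  let ?h = "hamiltonian_coeff H"
  note h = hamiltonian_coeff_smooth[OF H]
  have XV: "vector_field \<A> X" and X0: "\<And>p. \<alpha> p (X p) = 0"
    using X by (simp_all add: TVect_def)
  obtain v where v: "\<And>k. smooth_fun \<A> UNIV (v k)" and Xv: "X = lin_field frame v"
    by (rule frame_decomposition[OF XV]) blast
  have v0: "v None = (\<lambda>p. 0)"
    using X0 by (auto simp: Xv contact_form_lin_field)
  define w where "w k p = lin_field frame ?h p (v k) - lin_field frame v p (?h k) +
      (if k = None then frame_form (\<lambda>l. ?h l p) (\<lambda>l. v l p) else 0)" for k p
  have bw: "bracket \<A> (contact_field \<A> \<alpha> H) X = lin_field frame w"
    unfolding contact_field_eq[OF H] Xv bracket_lin_field_frame[OF h v] w_def ..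
  \<comment> \<open>By construction \<open>frame_form\<close> of \<open>?h\<close> and a tangent
    \<open>v\<close> is \<open>v(H)\<close>, which meets the term \<open>- v(H)\<close> coming from
    \<open>?h None = H\<close>.\<close>
  have w0: "w None = (\<lambda>p. 0)"
  proof
    fix p
    have "lin_field frame ?h p (\<lambda>p. 0) = 0"
      by (rule tangent_const[OF lin_field_frame_tangent[OF h]])
    then show "w None p = 0"
      by (simp add: w_def v0 lin_field_def[of frame v] frame_form_def sum_option_sum sum.distrib
          sum_subtractf sum_negf mult.commute)
  qed
  have bV: "vector_field \<A> (lin_field frame w)"
    unfolding bw[symmetric] contact_field_eq[OF H]
    by (rule bracket_vector_field[OF lin_field_vector_field[OF frame_vector_field h] XV])
  \<comment> \<open>As a vector field the bracket has some smooth coefficients, and by uniqueness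
    these are \<open>w\<close>.\<close>
  have ws: "smooth_fun \<A> UNIV (w k)" for k
    using frame_decomposition[OF bV] lin_field_frame_inject by metis
  have "lin_field frame w \<in> TVect \<A> \<alpha>"
    using bV by (simp add: TVect_def contact_form_lin_field w0)
  moreover have "(\<chi> k. w (Some k) p) = componentwise (lin_field frame ?h) (\<lambda>p. \<chi> k. v (Some k) p) p -
      block_matrix (second_deriv A B H p) (second_deriv B B H p)
        (- second_deriv A A H p) (- second_deriv B A H p) *v (\<chi> k. v (Some k) p)" for p
  proof -
    \<comment> \<open>The lower rows differentiate \<open>- A_i(H)\<close>. Pulling out the sign, by
      linearity on the smooth function \<open>A_i(H)\<close>, produces the minus signs of the lower
      blocks.\<close>
    have neg: "frame k p (\<lambda>q. - A i q H) = - frame k p (\<lambda>q. A i q H)" for k i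
    proof -
      have "smooth_near \<A> p (\<lambda>q. frame (Some (Inl i)) q H)"
        by (rule vector_field_smooth_near[OF frame_vector_field open_UNIV UNIV_I
              smooth_near_of_smooth_fun[OF open_UNIV UNIV_I H]])
      from tangent_scale[OF frame_tangent this, of k "-1"] show ?thesis by simp
    qed
    note negs = neg[of "Some (Inl j)" for j, simplified] neg[of "Some (Inr j)" for j, simplified]
    have sums: "(\<Sum>k\<in>UNIV. g k) = (\<Sum>i\<in>UNIV. g (Inl i)) + (\<Sum>i\<in>UNIV. g (Inr i))"
      for g :: "'n + 'n \<Rightarrow> complex"
      unfolding UNIV_Plus_UNIV[symmetric] by (subst sum.Plus) simp_all
    have "w (Some k) p = (componentwise (lin_field frame ?h) (\<lambda>p. \<chi> k. v (Some k) p) p -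
      block_matrix (second_deriv A B H p) (second_deriv B B H p)
        (- second_deriv A A H p) (- second_deriv B A H p) *v (\<chi> k. v (Some k) p)) $ k" for k
      by (cases k) (simp_all add: w_def componentwise_def matrix_vector_mult_def block_matrix_def
          second_deriv_def sums lin_field_def[of frame v] sum_option_sum v0 negs sum_negf mult.commute)
    then show ?thesis by (simp add: vec_eq_iff)
  qed
  ultimately show ?thesis
    unfolding bw coeff_column_lin_field[of w, OF ws w0] unfolding contact_field_eq[OF H] Xv
      coeff_column_lin_field[of v, OF v v0] by simp
qed

end

theorem proposition5p4:
  fixes \<A> :: "('a::{t2_space,second_countable_topology}, 'e::euclidean_space) atlas"
    and \<alpha> :: "'a \<Rightarrow> 'a tvec \<Rightarrow> complex"
    and A B :: "'n::finite \<Rightarrow> 'a vfield"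
    and Z X :: "'a vfield"
    and H :: "'a \<Rightarrow> complex"
  assumes "smooth_atlas \<A>"
    and "DIM('e) = 2 * CARD('n) + 1"
    and "heisenberg_structure \<A> \<alpha> A B Z"
    and "smooth_fun \<A> UNIV H"
    and "X \<in> TVect \<A> \<alpha>"
  shows "bracket \<A> (contact_field \<A> \<alpha> H) X \<in> TVect \<A> \<alpha> \<and>
    coeff_column \<A> A B (bracket \<A> (contact_field \<A> \<alpha> H) X) =
      (\<lambda>p. componentwise (contact_field \<A> \<alpha> H) (coeff_column \<A> A B X) p -
        block_matrix (second_deriv A B H p) (second_deriv B B H p)
          (- second_deriv A A H p) (- second_deriv B A H p) *v coeff_column \<A> A B X p)"
proof -
  interpret heisenberg \<A> \<alpha> A B Z
    by unfold_locales (use assms(1-3) in auto)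
  show ?thesis using assms(4,5) by (rule contact_action_on_columns)
qed

end
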